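(* Let $0\ne f\in\langle x_1,\dots,x_n\rangle\lhd\mathbb{C}\{x_1,\dots,x_n\}$ and $X=V(f)$. If the singular locus $\operatorname{Sing}X$ is quasihomogeneous, then $f$ is strongly Euler homogeneous, i.e. $f\in\langle x_1,\dots,x_n\rangle\cdot\mathcal J_f$ where $\mathcal J_f=\langle \partial f/\partial x_1,\dots,\partial f/\partial x_n\rangle$.
   Context: $\operatorname{Sing}X$ is the space germ with local algebra $\mathcal O_{\operatorname{Sing}X}=\mathbb{C}\{x_1,\dots,x_n\}/\tilde{\mathcal J}_f$, where $\tilde{\mathcal J}_f=\langle \partial f/\partial x_1,\dots,\partial f/\partial x_n,f\rangle$. A space germ with local analytic algebra $(\mathcal O,\mathfrak m)$ is quasihomogeneous if there exist minimal generators $y_1,\dots,y_m$ of $\mathfrak m$, positive rationals $w_1,\dots,w_m$ and a $\mathbb{C}$-linear derivation $\chi:\mathcal O\to\mathcal O$ with $\chi(y_i)=w_iy_i$ for all $i$ (an Euler derivation $\chi=\sum_i w_iy_i\,\partial/\partial y_i$). *)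

theory Defs
  imports "HOL-Analysis.Analysis"
begin

text \<open>Elements of the ring C{x_1,...,x_n} are represented by functions
  complex^'n \<Rightarrow> complex that are given near 0 by a convergent power series;
  two such functions represent the same element iff they agree near 0.\<close>

definition cps :: "(complex^'n::finite \<Rightarrow> complex) \<Rightarrow> bool" where
  "cps g \<longleftrightarrow> (\<exists>(c :: ('n \<Rightarrow> nat) \<Rightarrow> complex) e. e > 0 \<and>
     (\<forall>z. norm z < e \<longrightarrow>
        ((\<lambda>\<alpha>. c \<alpha> * (\<Prod>i\<in>UNIV. (z $ i) ^ \<alpha> i)) has_sum g z) UNIV))"

definition pd :: "'n::finite \<Rightarrow> (complex^'n \<Rightarrow> complex) \<Rightarrow> (complex^'n \<Rightarrow> complex)" where
  "pd i g = (\<lambda>z. deriv (\<lambda>t::complex. g (z + t *s axis i 1)) 0)"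

definition ideal_gen :: "(complex^'n::finite \<Rightarrow> complex) set \<Rightarrow> (complex^'n \<Rightarrow> complex) \<Rightarrow> bool" where
  "ideal_gen S g \<longleftrightarrow> (\<exists>F a. finite F \<and> F \<subseteq> S \<and> (\<forall>h\<in>F. cps (a h)) \<and>
      (\<forall>\<^sub>F z in nhds 0. g z = (\<Sum>h\<in>F. a h z * h z)))"

definition max_ideal :: "(complex^'n::finite \<Rightarrow> complex) set" where
  "max_ideal = {g. cps g \<and> g 0 = 0}"

definition congr :: "(complex^'n::finite \<Rightarrow> complex) set \<Rightarrow> (complex^'n \<Rightarrow> complex) \<Rightarrow> (complex^'n \<Rightarrow> complex) \<Rightarrow> bool" where
  "congr S g h \<longleftrightarrow> ideal_gen S (\<lambda>z. g z - h z)"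

text \<open>ys (representatives) generate the maximal ideal of C{x}/<S>.\<close>
definition gens_max :: "(complex^'n::finite \<Rightarrow> complex) set \<Rightarrow> (complex^'n \<Rightarrow> complex) list \<Rightarrow> bool" where
  "gens_max S ys \<longleftrightarrow> (\<forall>y\<in>set ys. y \<in> max_ideal) \<and> (\<forall>g\<in>max_ideal. ideal_gen (S \<union> set ys) g)"

definition min_gens_max :: "(complex^'n::finite \<Rightarrow> complex) set \<Rightarrow> (complex^'n \<Rightarrow> complex) list \<Rightarrow> bool" where
  "min_gens_max S ys \<longleftrightarrow> gens_max S ys \<and> (\<forall>zs. gens_max S zs \<longrightarrow> length ys \<le> length zs)"

text \<open>A C-linear derivation of C{x}/<S>, given on representatives.\<close>
definition quot_derivation :: "(complex^'n::finite \<Rightarrow> complex) set \<Rightarrow>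
    ((complex^'n \<Rightarrow> complex) \<Rightarrow> (complex^'n \<Rightarrow> complex)) \<Rightarrow> bool" where
  "quot_derivation S D \<longleftrightarrow>
     (\<forall>g. cps g \<longrightarrow> cps (D g)) \<and>
     (\<forall>g h. cps g \<longrightarrow> cps h \<longrightarrow> congr S g h \<longrightarrow> congr S (D g) (D h)) \<and>
     (\<forall>g h. cps g \<longrightarrow> cps h \<longrightarrow> congr S (D (\<lambda>z. g z + h z)) (\<lambda>z. D g z + D h z)) \<and>
     (\<forall>c g. cps g \<longrightarrow> congr S (D (\<lambda>z. c * g z)) (\<lambda>z. c * D g z)) \<and>
     (\<forall>g h. cps g \<longrightarrow> cps h \<longrightarrow>
        congr S (D (\<lambda>z. g z * h z)) (\<lambda>z. g z * D h z + h z * D g z))"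

text \<open>The space germ with local algebra C{x}/<S> is quasihomogeneous.\<close>
definition quasihomogeneous :: "(complex^'n::finite \<Rightarrow> complex) set \<Rightarrow> bool" where
  "quasihomogeneous S \<longleftrightarrow> (\<exists>ys (w :: nat \<Rightarrow> real) D.
     min_gens_max S ys \<and> (\<forall>i<length ys. w i \<in> \<rat> \<and> w i > 0) \<and>
     quot_derivation S D \<and>
     (\<forall>i<length ys. congr S (D (ys ! i)) (\<lambda>z. complex_of_real (w i) * (ys ! i) z)))"

definition sing_gens :: "(complex^'n::finite \<Rightarrow> complex) \<Rightarrow> (complex^'n \<Rightarrow> complex) set" where
  "sing_gens f = insert f (range (\<lambda>i. pd i f))"

definition strongly_euler_homogeneous :: "(complex^'n::finite \<Rightarrow> complex) \<Rightarrow> bool" where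
  "strongly_euler_homogeneous f \<longleftrightarrow>
     ideal_gen {(\<lambda>z. z $ j * pd i f z) | i j. True} f"

end

theory Submission
  imports Defs "HOL-Library.Function_Algebras"
begin

text \<open>
  Let \<open>I = \<langle>\<partial>\<^sub>1f, \<dots>, \<partial>\<^sub>nf, f\<rangle>\<close> and let \<open>m\<close> be the maximal ideal of \<open>C{x}\<close>. An Euler derivation
  of \<open>C{x}/I\<close> lifts to a vector field \<open>\<chi> = \<Sum> a\<^sub>i \<partial>\<^sub>i\<close> with \<open>\<chi> I \<subseteq> I\<close>, and changing the \<open>a\<^sub>i\<close> by elements
  of \<open>I\<close> one can arrange that \<open>a\<^sub>i \<in> m\<close> and that \<open>\<chi>\<close> acts on \<open>m/m\<^sup>2\<close> diagonally with positive eigenvalues.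
  Then some product \<open>(\<chi> - \<lambda>\<^sub>1) \<cdots> (\<chi> - \<lambda>\<^sub>r)\<close> with all \<open>\<lambda>\<^sub>i > 0\<close> maps \<open>f\<close> into \<open>m\<^sup>k\<close>. The space
  \<open>A = {g. \<forall>j. \<partial>\<^sub>j g \<in> I}\<close> contains \<open>f\<close>, is stable under \<open>\<chi>\<close>, and \<open>\<chi> A \<subseteq> m I\<close>; so expanding the product
  gives \<open>f \<in> m I + m\<^sup>k\<close> for every \<open>k\<close>. Krull's intersection theorem yields \<open>f \<in> m I\<close>, and
  Nakayama's lemma removes the generator \<open>f\<close> of \<open>I\<close>. If instead some \<open>\<partial>\<^sub>if\<close> is a unit, \<open>f \<in> m I\<close> is clear.

  Krull's theorem for \<open>C{x}\<close> is proved with standard bases. Exponents \<open>\<alpha>\<close> are ordered by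
  \<open>p\<^sub>1^\<alpha>\<^sub>1 \<cdots> p\<^sub>n^\<alpha>\<^sub>n\<close> for distinct primes \<open>p\<^sub>i\<close>, and convergence is measured on the polydisc of radii
  \<open>p\<^sub>i^(-s)\<close>: for large \<open>s\<close> the leading term of a series dominates its tail, so division with
  remainder converges.
\<close>

section \<open>Multivariate power series\<close>

definition index_prime :: "'n::finite \<Rightarrow> nat" where
  "index_prime = (SOME p. inj p \<and> (\<forall>i. prime (p i)))"

lemma index_prime: "inj (index_prime :: 'n::finite \<Rightarrow> nat)" "prime (index_prime (i::'n))"
proof -
  obtain h :: "'n \<Rightarrow> nat" where h: "bij_betw h UNIV {0..<CARD('n)}"
    using ex_bij_betw_finite_nat[of "UNIV :: 'n set"] by auto
  obtain e :: "nat \<Rightarrow> nat" where e: "inj e" "range e \<subseteq> {p. prime p}"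
    using infinite_countable_subset[OF primes_infinite] by auto
  have "inj (e \<circ> h) \<and> (\<forall>i. prime ((e \<circ> h) i))"
    using h e by (auto intro!: inj_compose simp: bij_betw_def)
  then have "\<exists>p :: 'n \<Rightarrow> nat. inj p \<and> (\<forall>i. prime (p i))"
    by blast
  from someI_ex[OF this, folded index_prime_def]
  show "inj (index_prime :: 'n \<Rightarrow> nat)" "prime (index_prime (i::'n))"
    by auto
qed

lemma index_prime_ge_2: "2 \<le> index_prime i"
  by (rule prime_ge_2_nat[OF index_prime(2)])

text \<open>Comparing codes is a monomial order: codes turn sums into products, are injective by
  unique factorisation, and every exponent has only finitely many predecessors. The last point
  allows recursion over exponents.\<close>

definition enc :: "('n::finite \<Rightarrow> nat) \<Rightarrow> nat" where
  "enc \<alpha> = (\<Prod>i\<in>UNIV. index_prime i ^ \<alpha> i)"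

definition deg :: "('n::finite \<Rightarrow> nat) \<Rightarrow> nat" where
  "deg \<alpha> = (\<Sum>i\<in>UNIV. \<alpha> i)"

definition unit_exp :: "'n \<Rightarrow> 'n \<Rightarrow> nat" where
  "unit_exp i = (\<lambda>j. if j = i then 1 else 0)"

definition mono_at :: "complex^'n::finite \<Rightarrow> ('n \<Rightarrow> nat) \<Rightarrow> complex" where
  "mono_at z \<alpha> = (\<Prod>i\<in>UNIV. z $ i ^ \<alpha> i)"

text \<open>The monomial evaluated at the polyradius with entries \<open>p_i^(-s)\<close>. By
  \<open>wt_eq\<close> this is the code to the power \<open>-s\<close>, so raising \<open>s\<close>
  favours exponents with small code.\<close>

definition wt :: "nat \<Rightarrow> ('n::finite \<Rightarrow> nat) \<Rightarrow> real" where
  "wt s \<alpha> = (\<Prod>i\<in>UNIV. (1 / real (index_prime i) ^ s) ^ \<alpha> i)"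

lemma enc_add: "enc (\<alpha> + \<beta>) = enc \<alpha> * enc \<beta>"
  by (simp add: enc_def power_add prod.distrib)

lemma enc_pos: "0 < enc \<alpha>"
  unfolding enc_def by (intro prod_pos) (auto simp: prime_gt_0_nat index_prime(2))

lemma deg_add: "deg (\<alpha> + \<beta>) = deg \<alpha> + deg \<beta>"
  by (simp add: deg_def sum.distrib)

lemma deg_unit_exp [simp]: "deg (unit_exp i) = 1"
  by (simp add: deg_def unit_exp_def)

lemma deg_eq_0_iff [simp]: "deg \<alpha> = 0 \<longleftrightarrow> \<alpha> = 0"
  by (auto simp: deg_def fun_eq_iff)

lemma unit_exp_le_iff: "unit_exp i \<le> \<alpha> \<longleftrightarrow> 0 < \<alpha> i"
  by (auto simp: unit_exp_def le_fun_def)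

lemma exp_diff_add [simp]: "\<beta> \<le> \<alpha> \<Longrightarrow> \<alpha> - \<beta> + \<beta> = (\<alpha> :: 'n \<Rightarrow> nat)"
  by (auto simp: fun_eq_iff le_fun_def)

lemma exp_add_diff [simp]: "\<beta> \<le> \<alpha> \<Longrightarrow> \<beta> + (\<alpha> - \<beta>) = (\<alpha> :: 'n \<Rightarrow> nat)"
  by (auto simp: fun_eq_iff le_fun_def)

lemma exp_add_diff_cancel [simp]:
  "\<alpha> + \<beta> - \<beta> = (\<alpha> :: 'n \<Rightarrow> nat)" "\<beta> + \<alpha> - \<beta> = (\<alpha> :: 'n \<Rightarrow> nat)"
  by (auto simp: fun_eq_iff)

lemma exp_le_add [simp]: "\<alpha> \<le> \<alpha> + (\<beta> :: 'n \<Rightarrow> nat)" "\<alpha> \<le> \<beta> + (\<alpha> :: 'n \<Rightarrow> nat)"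
  by (auto simp: le_fun_def)

lemma finite_exp_le: "finite {\<beta>. \<beta> \<le> (\<alpha> :: 'n::finite \<Rightarrow> nat)}"
proof -
  have "{\<beta>. \<beta> \<le> \<alpha>} \<subseteq> PiE UNIV (\<lambda>i. {..\<alpha> i})"
    by (auto simp: le_fun_def)
  then show ?thesis
    by (rule finite_subset) (auto intro: finite_PiE)
qed

lemma inj_enc: "inj (enc :: ('n::finite \<Rightarrow> nat) \<Rightarrow> nat)"
proof (rule injI, rule ext)
  fix \<alpha> \<beta> :: "'n \<Rightarrow> nat" and i
  assume eq: "enc \<alpha> = enc \<beta>"
  have "multiplicity (index_prime i) (enc \<gamma>) = \<gamma> i" for \<gamma> :: "'n \<Rightarrow> nat"
  proof -
    have "enc \<gamma> = (\<Prod>p\<in>range (index_prime :: 'n \<Rightarrow> nat). p ^ \<gamma> (inv index_prime p))"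
      by (simp add: enc_def prod.reindex[OF index_prime(1)] inv_f_f[OF index_prime(1)])
    also have "multiplicity (index_prime i) \<dots> = \<gamma> i"
      using index_prime(2)
      by (subst multiplicity_prod_prime_powers) (auto simp: inv_f_f[OF index_prime(1)])
    finally show ?thesis .
  qed
  with eq show "\<alpha> i = \<beta> i"
    by metis
qed

lemma finite_enc_le: "finite {\<alpha> :: 'n::finite \<Rightarrow> nat. enc \<alpha> \<le> K}"
  using finite_vimageI[OF finite_atMost[of K] inj_enc] by (simp add: vimage_def)

text \<open>All primes are at least 2, so the code is at least \<open>2 ^ deg \<alpha>\<close>.
  Hence coefficients that vanish in all degrees below K vanish at all codes up to K.\<close>

lemma deg_less_enc: "deg \<alpha> < enc \<alpha>"
proof -
  have "2 ^ deg \<alpha> = (\<Prod>i\<in>UNIV. 2 ^ \<alpha> i :: nat)"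
    by (simp add: deg_def power_sum)
  also have "\<dots> \<le> enc \<alpha>"
    unfolding enc_def using index_prime_ge_2 by (intro prod_mono) (auto intro: power_mono)
  finally show ?thesis
    using less_exp[of "deg \<alpha>"] by linarith
qed

lemma mono_at_add: "mono_at z (\<alpha> + \<beta>) = mono_at z \<alpha> * mono_at z \<beta>"
  by (simp add: mono_at_def power_add prod.distrib)

lemma mono_at_0 [simp]: "mono_at z 0 = 1"
  by (simp add: mono_at_def)

lemma mono_at_unit_exp [simp]: "mono_at z (unit_exp i) = z $ i"
  by (simp add: mono_at_def unit_exp_def if_distrib cong: if_cong)

lemma wt_add: "wt s (\<alpha> + \<beta>) = wt s \<alpha> * wt s \<beta>"
  by (simp add: wt_def power_add prod.distrib)

lemma wt_eq: "wt s \<alpha> = 1 / real (enc \<alpha>) ^ s"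
  by (simp add: wt_def enc_def prod_power_distrib power_one_over prod_dividef
      flip: power_mult mult.commute[of s])

lemma wt_pos: "0 < wt s \<alpha>"
  by (simp add: wt_eq enc_pos)

lemma wt_nonneg [simp]: "0 \<le> wt s \<alpha>"
  by (rule less_imp_le[OF wt_pos])

lemma norm_mono_at_le:
  assumes "\<And>i. norm (z $ i) \<le> 1 / real (index_prime i) ^ s"
  shows "norm (mono_at z \<alpha>) \<le> wt s \<alpha>"
  unfolding mono_at_def wt_def prod_norm[symmetric] norm_power
  using assms by (intro prod_mono) (auto intro!: power_mono)

lemma eventually_in_polydisc:
  "\<forall>\<^sub>F z :: complex^'n::finite in nhds 0. \<forall>i. norm (z $ i) < 1 / real (index_prime i) ^ s"
proof -
  have "\<forall>\<^sub>F z :: complex^'n in nhds 0. norm (z $ i) < 1 / real (index_prime i) ^ s" for i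
  proof -
    have "((\<lambda>z :: complex^'n. norm (z $ i)) \<longlongrightarrow> 0) (nhds 0)"
      by (auto intro!: tendsto_eq_intros filterlim_ident)
    moreover have "0 < 1 / real (index_prime i) ^ s"
      using index_prime_ge_2[of i] by simp
    ultimately show ?thesis
      by (rule order_tendstoD)
  qed
  then show ?thesis
    by (simp add: eventually_all_finite)
qed

section \<open>Expansions near 0 and absolute convergence on polydiscs\<close>

definition represents :: "(('n::finite \<Rightarrow> nat) \<Rightarrow> complex) \<Rightarrow> (complex^'n \<Rightarrow> complex) \<Rightarrow> bool" where
  "represents c g \<longleftrightarrow> (\<forall>\<^sub>F z in nhds 0. ((\<lambda>\<alpha>. c \<alpha> * mono_at z \<alpha>) has_sum g z) UNIV)"

text \<open>Finiteness of a weighted l1 norm, that is, absolute convergence on the closed polydisc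
  of parameter \<open>s\<close>; division with remainder is estimated in this norm.\<close>

definition conv_at :: "nat \<Rightarrow> (('n::finite \<Rightarrow> nat) \<Rightarrow> complex) \<Rightarrow> bool" where
  "conv_at s c \<longleftrightarrow> (\<lambda>\<alpha>. norm (c \<alpha>) * wt s \<alpha>) summable_on UNIV"

lemma cps_iff_represents: "cps g \<longleftrightarrow> (\<exists>c. represents c g)"
  unfolding cps_def represents_def mono_at_def eventually_nhds_metric dist_norm by simp

text \<open>The points \<open>\<rho> s\<close> with coordinates \<open>p_i^(-s)\<close> tend to 0,
  so the expansion eventually holds there. Unordered summability of complex terms is absolute, and
  at these points the monomials have exactly the weights as absolute values.\<close>

lemma represents_conv_at:
  fixes c :: "('n::finite \<Rightarrow> nat) \<Rightarrow> complex"
  assumes "represents c g"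
  shows "\<forall>\<^sub>F s in sequentially. conv_at s c"
proof -
  define \<rho> where "\<rho> s = (\<chi> i. complex_of_real (1 / real (index_prime (i::'n)) ^ s))" for s :: nat
  have "\<rho> \<longlonglongrightarrow> 0"
  proof (rule vec_tendstoI)
    fix i
    have "(\<lambda>s. (1 / real (index_prime (i::'n))) ^ s) \<longlonglongrightarrow> 0"
      using index_prime_ge_2[of i] by (intro LIMSEQ_power_zero) auto
    from tendsto_of_real[OF this, where 'a = complex]
    show "(\<lambda>s. \<rho> s $ i) \<longlonglongrightarrow> 0 $ i"
      by (simp add: \<rho>_def power_one_over)
  qed
  then have "\<forall>\<^sub>F s in sequentially. ((\<lambda>\<alpha>. c \<alpha> * mono_at (\<rho> s) \<alpha>) has_sum g (\<rho> s)) UNIV"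
    using assms unfolding represents_def by (rule eventually_compose_filterlim[rotated])
  then show ?thesis
  proof eventually_elim
    case (elim s)
    then have "(\<lambda>\<alpha>. c \<alpha> * mono_at (\<rho> s) \<alpha>) summable_on UNIV"
      by (rule has_sum_imp_summable)
    then have "(\<lambda>\<alpha>. norm (c \<alpha> * mono_at (\<rho> s) \<alpha>)) summable_on UNIV"
      by (simp add: summable_on_iff_abs_summable_on_complex)
    moreover have "norm (mono_at (\<rho> s) \<alpha>) = wt s \<alpha>" for \<alpha>
      by (simp add: mono_at_def wt_def \<rho>_def prod_norm[symmetric] norm_power norm_divide)
    ultimately show ?case
      by (simp add: conv_at_def norm_mult)
  qed
qed

lemma conv_at_has_sum:
  assumes "conv_at s c" "\<And>i. norm (z $ i) \<le> 1 / real (index_prime i) ^ s"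
  shows "((\<lambda>\<alpha>. c \<alpha> * mono_at z \<alpha>) has_sum (\<Sum>\<^sub>\<infinity>\<alpha>. c \<alpha> * mono_at z \<alpha>)) UNIV"
proof -
  have "(\<lambda>\<alpha>. norm (c \<alpha> * mono_at z \<alpha>)) summable_on UNIV"
    using assms(1) unfolding conv_at_def
  proof (rule summable_on_comparison_test)
    show "norm (c \<alpha> * mono_at z \<alpha>) \<le> norm (c \<alpha>) * wt s \<alpha>" for \<alpha>
      unfolding norm_mult by (rule mult_left_mono[OF norm_mono_at_le[OF assms(2)] norm_ge_zero])
  qed (rule norm_ge_zero)
  then show ?thesis
    by (rule has_sum_infsum[OF abs_summable_summable])
qed

lemma conv_at_represents:
  assumes "conv_at s c"
  shows "\<exists>g. represents c g"
proof
  show "represents c (\<lambda>z. \<Sum>\<^sub>\<infinity>\<alpha>. c \<alpha> * mono_at z \<alpha>)"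
    unfolding represents_def using eventually_in_polydisc[of s]
  proof eventually_elim
    case (elim z)
    show ?case
      by (rule conv_at_has_sum[OF assms less_imp_le[OF spec[OF elim]]])
  qed
qed

lemma represents_unique:
  assumes "represents c g" "represents c h"
  shows "\<forall>\<^sub>F z in nhds 0. g z = h z"
  using assms unfolding represents_def by eventually_elim (rule has_sum_unique)

lemma represents_cong:
  assumes "\<forall>\<^sub>F z in nhds 0. g z = h z" "represents c g"
  shows "represents c h"
  using assms unfolding represents_def by eventually_elim simp

lemma represents_add:
  assumes "represents c g" "represents d h"
  shows "represents (\<lambda>\<alpha>. c \<alpha> + d \<alpha>) (\<lambda>z. g z + h z)"
  using assms unfolding represents_def
  by eventually_elim (simp add: distrib_right has_sum_add)

lemma represents_cmult:
  assumes "represents c g"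
  shows "represents (\<lambda>\<alpha>. a * c \<alpha>) (\<lambda>z. a * g z)"
  using assms unfolding represents_def
  by eventually_elim (simp add: mult.assoc has_sum_cmult_right)

lemma represents_monomial:
  "represents (\<lambda>\<alpha>. if \<alpha> = \<beta> then a else 0) (\<lambda>z. a * mono_at z \<beta>)"
  unfolding represents_def by (auto intro!: always_eventually has_sum_finite_neutralI[of "{\<beta>}"] split: if_splits)

lemma represents_at_0:
  assumes "represents c g"
  shows "c 0 = g 0"
proof -
  have "((\<lambda>\<alpha>. c \<alpha> * mono_at 0 \<alpha>) has_sum g 0) UNIV"
    using assms unfolding represents_def by (rule eventually_nhds_x_imp_x)
  moreover have "((\<lambda>\<alpha>. c \<alpha> * mono_at 0 \<alpha>) has_sum c 0) UNIV"
    by (rule has_sum_finite_neutralI[of "{0}"]) (auto simp: mono_at_def fun_eq_iff)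
  ultimately show ?thesis
    by (metis has_sum_unique)
qed

section \<open>Products and termwise differentiation\<close>

definition cauchy_prod :: "(('n::finite \<Rightarrow> nat) \<Rightarrow> complex) \<Rightarrow> (('n \<Rightarrow> nat) \<Rightarrow> complex) \<Rightarrow> ('n \<Rightarrow> nat) \<Rightarrow> complex" where
  "cauchy_prod c d \<gamma> = (\<Sum>\<beta> | \<beta> \<le> \<gamma>. c \<beta> * d (\<gamma> - \<beta>))"

text \<open>Absolute convergence makes the family of products summable over pairs of exponents. The
  bijection from \<open>(\<alpha>, \<beta>)\<close> to \<open>(\<alpha> + \<beta>, \<alpha>)\<close>
  groups the pairs by their sum, and each fibre is a finite sum.\<close>

lemma represents_mult:
  fixes c d :: "('n::finite \<Rightarrow> nat) \<Rightarrow> complex"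
  assumes "represents c g" "represents d h"
  shows "represents (cauchy_prod c d) (\<lambda>z. g z * h z)"
  using assms unfolding represents_def
proof eventually_elim
  case (elim z)
  let ?u = "\<lambda>\<alpha>. c \<alpha> * mono_at z \<alpha>" and ?v = "\<lambda>\<alpha>. d \<alpha> * mono_at z \<alpha>"
  let ?p = "\<lambda>(\<alpha>, \<beta>). ?u \<alpha> * ?v \<beta>"
  have abs: "(\<lambda>\<alpha>. norm (?u \<alpha>)) summable_on UNIV" "(\<lambda>\<alpha>. norm (?v \<alpha>)) summable_on UNIV"
    using has_sum_imp_summable[OF elim(1)] has_sum_imp_summable[OF elim(2)]
    by (simp_all only: summable_on_iff_abs_summable_on_complex)
  have sum_p: "?p summable_on UNIV \<times> UNIV"
  proof (rule abs_summable_summable, rule summable_on_SigmaI)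
    show "((\<lambda>\<beta>. norm (?p (\<alpha>, \<beta>))) has_sum norm (?u \<alpha>) * (\<Sum>\<^sub>\<infinity>\<beta>. norm (?v \<beta>))) UNIV" for \<alpha>
      using has_sum_cmult_right[OF has_sum_infsum[OF abs(2)], of "norm (?u \<alpha>)"]
      by (simp only: prod.case norm_mult)
    show "(\<lambda>\<alpha>. norm (?u \<alpha>) * (\<Sum>\<^sub>\<infinity>\<beta>. norm (?v \<beta>))) summable_on UNIV"
      by (rule summable_on_cmult_left[OF abs(1)])
  qed simp
  have "(?p has_sum g z * h z) (UNIV \<times> UNIV)"
  proof (rule has_sum_SigmaI[OF _ _ sum_p])
    show "((\<lambda>\<beta>. ?p (\<alpha>, \<beta>)) has_sum ?u \<alpha> * h z) UNIV" for \<alpha>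
      unfolding prod.case by (rule has_sum_cmult_right[OF elim(2)])
    show "((\<lambda>\<alpha>. ?u \<alpha> * h z) has_sum g z * h z) UNIV"
      by (rule has_sum_cmult_left[OF elim(1)])
  qed
  also have "?this \<longleftrightarrow> ((\<lambda>(\<gamma>, \<beta>). c \<beta> * d (\<gamma> - \<beta>) * mono_at z \<gamma>) has_sum g z * h z)
      (Sigma UNIV (\<lambda>\<gamma>. {\<beta>. \<beta> \<le> \<gamma>}))"
  proof (rule has_sum_reindex_bij_witness[of _ "\<lambda>(\<gamma>, \<beta>). (\<beta>, \<gamma> - \<beta>)" "\<lambda>(\<alpha>, \<beta>). (\<alpha> + \<beta>, \<alpha>)"], goal_cases)
    case (3 b)
    then show ?case by (cases b) simp
  next
    case (5 a)
    show ?case by (simp add: split_beta mono_at_add)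
  qed (simp_all add: split_beta)
  finally show ?case
  proof (rule has_sum_SigmaD)
    fix \<gamma>
    show "((\<lambda>\<beta>. case (\<gamma>, \<beta>) of (\<gamma>, \<beta>) \<Rightarrow> c \<beta> * d (\<gamma> - \<beta>) * mono_at z \<gamma>) has_sum
        cauchy_prod c d \<gamma> * mono_at z \<gamma>) {\<beta>. \<beta> \<le> \<gamma>}"
      by (rule has_sum_finiteI) (simp_all add: finite_exp_le cauchy_prod_def sum_distrib_right)
  qed
qed

definition deriv_coeff :: "'n::finite \<Rightarrow> (('n \<Rightarrow> nat) \<Rightarrow> complex) \<Rightarrow> ('n \<Rightarrow> nat) \<Rightarrow> complex" where
  "deriv_coeff i c \<alpha> = of_nat (\<alpha> i + 1) * c (\<alpha> + unit_exp i)"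

text \<open>A second-order Taylor estimate whose constant does not depend on \<open>n\<close>: the
  factor \<open>n * (n - 1)\<close> is at most \<open>2 * 2 ^ n\<close>, which is absorbed by
  passing from radius \<open>r / 2\<close> to \<open>r\<close>.\<close>

lemma norm_power_diff_quadratic:
  fixes w t :: complex
  assumes "norm w \<le> r / 2" "norm (w + t) \<le> r / 2" "0 < r"
  shows "norm ((w + t) ^ n - w ^ n - t * (of_nat n * w ^ (n - 1))) \<le> 8 / r\<^sup>2 * r ^ n * (norm t)\<^sup>2"
proof (cases "t = 0")
  case False
  have sq: "m * (m - 1) \<le> 2 * 2 ^ m" for m :: nat
  proof (induction m rule: nat_induct)
    case (Suc m)
    have "2 * m \<le> 2 * 2 ^ m"
      using less_exp[of m] by simp
    moreover have "Suc m * (Suc m - 1) = m * (m - 1) + 2 * m"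
      by (cases m) auto
    ultimately show ?case
      using Suc unfolding power_Suc by linarith
  qed simp
  have "norm (((w + t) ^ n - w ^ n) / t - of_nat n * w ^ (n - Suc 0))
      \<le> real n * real (n - Suc 0) * (r / 2) ^ (n - 2) * norm t"
    by (rule lemma_termdiff3[OF False assms(1,2)])
  also have "\<dots> \<le> 8 / r\<^sup>2 * r ^ n * norm t"
  proof (cases "n < 2")
    case True
    then have "n = 0 \<or> n = 1" by auto
    then show ?thesis using assms(3) by auto
  next
    case ge: False
    have "real (n * (n - 1)) \<le> real (2 * 2 ^ n)"
      using sq[of n] by (simp only: of_nat_le_iff)
    then have "real n * real (n - Suc 0) * (r / 2) ^ (n - 2) \<le> 2 * 2 ^ n * (r / 2) ^ (n - 2)"
      using assms(3) by (intro mult_right_mono) auto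
    also have "\<dots> = 8 / r\<^sup>2 * r ^ n"
      using ge assms(3) by (simp add: power_diff power_divide)
    finally show ?thesis
      by (rule mult_right_mono) auto
  qed
  finally have "norm t * norm (((w + t) ^ n - w ^ n) / t - of_nat n * w ^ (n - Suc 0))
      \<le> norm t * (8 / r\<^sup>2 * r ^ n * norm t)"
    by (rule mult_left_mono) auto
  also have "norm t * norm (((w + t) ^ n - w ^ n) / t - of_nat n * w ^ (n - Suc 0)) =
      norm ((w + t) ^ n - w ^ n - t * (of_nat n * w ^ (n - 1)))"
    using False by (subst norm_mult[symmetric]) (simp add: right_diff_distrib diff_divide_distrib)
  finally show ?thesis
    by (simp add: power2_eq_square mult_ac)
qed auto

text \<open>Doubling the radius again pays for the factor \<open>n\<close>, here by n \<le> 2^(n-1)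
  for positive \<open>n\<close>.\<close>

lemma norm_power_deriv_le:
  fixes w :: complex
  assumes "norm w \<le> r / 2" "0 < r"
  shows "norm (of_nat n * w ^ (n - 1)) \<le> r ^ n / r"
proof (cases n)
  case (Suc m)
  have "real n * norm w ^ m \<le> 2 ^ m * (r / 2) ^ m"
    using Suc less_exp[of m] assms
    by (intro mult_mono power_mono) (auto simp: Suc_le_eq simp flip: of_nat_Suc intro: order_trans[OF of_nat_mono])
  then show ?thesis
    unfolding Suc norm_mult norm_power norm_of_nat using assms by (simp add: power_divide)
qed (use assms in auto)

text \<open>All variables but \<open>i\<close> are frozen, and the Taylor remainders of the powers
  of the remaining one are summed against the weights; the total is at most a constant times the
  square of the increment. The second claim is needed along with the first because
  \<open>deriv\<close> by itself does not assert differentiability.\<close>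

lemma
  fixes c :: "('n::finite \<Rightarrow> nat) \<Rightarrow> complex"
  assumes "represents c g"
  shows represents_pd: "represents (deriv_coeff i c) (pd i g)"
    and represents_has_field_derivative:
      "\<forall>\<^sub>F z in nhds 0. ((\<lambda>t. g (z + t *s axis i 1)) has_field_derivative pd i g z) (at 0)"
proof -
  obtain s where s: "conv_at s c"
    using represents_conv_at[OF assms] by (meson eventually_sequentially order_refl)
  obtain U where U: "open U" "0 \<in> U" "\<And>z. z \<in> U \<Longrightarrow> ((\<lambda>\<alpha>. c \<alpha> * mono_at z \<alpha>) has_sum g z) UNIV"
    using assms unfolding represents_def eventually_nhds by blast
  define r where "r = 1 / real (index_prime i) ^ s"
  have r: "0 < r"
    using index_prime_ge_2[of i] by (simp add: r_def)
  \<comment> \<open>The \<open>i\<close>-th coordinate is kept within half the radius, as the two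
    power estimates require.\<close>
  define W where "W = {z \<in> U. (\<forall>j. norm (z $ j) < 1 / real (index_prime j) ^ s) \<and> norm (z $ i) < r / 2}"
  have ev: "\<forall>\<^sub>F z in nhds 0. z \<in> W"
  proof -
    have "((\<lambda>z :: complex^'n. norm (z $ i)) \<longlongrightarrow> 0) (nhds 0)"
      by (auto intro!: tendsto_eq_intros filterlim_ident)
    then have "\<forall>\<^sub>F z :: complex^'n in nhds 0. norm (z $ i) < r / 2"
      using r by (intro order_tendstoD) auto
    moreover have "\<forall>\<^sub>F z in nhds 0. z \<in> U"
      using U by (auto simp: eventually_nhds)
    ultimately show ?thesis
      using eventually_in_polydisc[of s] by eventually_elim (simp add: W_def)
  qed
  define P where "P z \<alpha> = (\<Prod>j\<in>UNIV-{i}. z $ j ^ \<alpha> j)" for z :: "complex^'n" and \<alpha> :: "'n \<Rightarrow> nat"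
  have mono_at_P: "mono_at z \<alpha> = z $ i ^ \<alpha> i * P z \<alpha>" for z \<alpha>
    unfolding mono_at_def P_def by (rule prod.remove) auto
  have P_le: "norm (P z \<alpha>) * r ^ \<alpha> i \<le> wt s \<alpha>" if "z \<in> W" for z \<alpha>
  proof -
    have "norm (P z \<alpha>) \<le> (\<Prod>j\<in>UNIV-{i}. (1 / real (index_prime j) ^ s) ^ \<alpha> j)"
      unfolding P_def prod_norm[symmetric] norm_power
      using that by (intro prod_mono) (auto intro!: power_mono simp: W_def intro: less_imp_le)
    then have "norm (P z \<alpha>) * r ^ \<alpha> i \<le> (\<Prod>j\<in>UNIV-{i}. (1 / real (index_prime j) ^ s) ^ \<alpha> j) * r ^ \<alpha> i"
      using r by (intro mult_right_mono) auto
    also have "\<dots> = wt s \<alpha>"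
      unfolding wt_def r_def by (subst prod.remove[of UNIV i]) (auto simp: mult.commute)
    finally show ?thesis .
  qed
  define T where "T z \<alpha> = c \<alpha> * (of_nat (\<alpha> i) * z $ i ^ (\<alpha> i - 1) * P z \<alpha>)" for z \<alpha>
  define G where "G z = infsum (T z) UNIV" for z
  have T: "(T z has_sum G z) UNIV" if z: "z \<in> W" for z
  proof -
    have "(\<lambda>\<alpha>. norm (c \<alpha>) * wt s \<alpha> * (1 / r)) summable_on UNIV"
      using s unfolding conv_at_def by (rule summable_on_cmult_left)
    then have "(\<lambda>\<alpha>. norm (T z \<alpha>)) summable_on UNIV"
    proof (rule summable_on_comparison_test)
      fix \<alpha>
      have "norm (T z \<alpha>) \<le> norm (c \<alpha>) * (r ^ \<alpha> i / r * norm (P z \<alpha>))"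
        unfolding T_def norm_mult[of "c \<alpha>"] norm_mult[of _ "P z \<alpha>"]
        using z r by (intro mult_left_mono mult_right_mono norm_power_deriv_le) (auto simp: W_def)
      also have "\<dots> = norm (c \<alpha>) * (norm (P z \<alpha>) * r ^ \<alpha> i) * (1 / r)"
        by simp
      also have "\<dots> \<le> norm (c \<alpha>) * wt s \<alpha> * (1 / r)"
        using r by (intro mult_right_mono mult_left_mono P_le z) auto
      finally show "norm (T z \<alpha>) \<le> norm (c \<alpha>) * wt s \<alpha> * (1 / r)" .
    qed auto
    then show ?thesis
      unfolding G_def by (rule has_sum_infsum[OF abs_summable_summable])
  qed
  have der: "((\<lambda>t. g (z + t *s axis i 1)) has_field_derivative G z) (at 0)" if z: "z \<in> W" for z
  proof -
    define B where "B = 8 / r\<^sup>2 * infsum (\<lambda>\<alpha>. norm (c \<alpha>) * wt s \<alpha>) UNIV"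
    let ?h = "\<lambda>t. z + t *s axis i 1"
    have h_nth: "?h t $ j = (if j = i then z $ i + t else z $ j)" for t j
      by (simp add: axis_def)
    have lim_h: "(?h \<longlongrightarrow> z) (at 0)"
      by (rule vec_tendstoI) (auto simp: axis_def intro!: tendsto_eq_intros)
    have "\<forall>\<^sub>F t in at 0. ?h t \<in> U"
      using lim_h U(1) z by (intro topological_tendstoD) (auto simp: W_def)
    moreover have "\<forall>\<^sub>F t in at 0. norm (?h t $ i) < r / 2"
      using z by (intro order_tendstoD(2)[OF tendsto_norm[OF tendsto_vec_nth[OF lim_h]]]) (auto simp: W_def)
    ultimately have "\<forall>\<^sub>F t in at 0. norm ((g (?h t) - g z) / t - G z) \<le> B * norm t"
      using eventually_neq_at_within[of 0]
    proof eventually_elim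
      case (elim t)
      have z': "((\<lambda>\<alpha>. c \<alpha> * mono_at z \<alpha>) has_sum g z) UNIV"
        using z by (intro U) (auto simp: W_def)
      have P_eq: "P (?h t) \<alpha> = P z \<alpha>" for \<alpha>
        unfolding P_def by (intro prod.cong) (auto simp: axis_def)
      \<comment> \<open>The first-order Taylor remainder of a single term; summed over all exponents
        it gives the remainder of \<open>g\<close>.\<close>
      define E where "E \<alpha> = c \<alpha> * mono_at (?h t) \<alpha> + (- 1 * (c \<alpha> * mono_at z \<alpha>) + - t * T z \<alpha>)" for \<alpha>
      have E: "(E has_sum (g (?h t) + (- 1 * g z + - t * G z))) UNIV"
        unfolding E_def using elim by (intro has_sum_add has_sum_cmult_right z' T z U)
      have E_le: "norm (E \<alpha>) \<le> 8 / r\<^sup>2 * (norm t)\<^sup>2 * (norm (c \<alpha>) * wt s \<alpha>)" for \<alpha>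
      proof -
        have "E \<alpha> = c \<alpha> * (((z $ i + t) ^ \<alpha> i - z $ i ^ \<alpha> i - t * (of_nat (\<alpha> i) * z $ i ^ (\<alpha> i - 1))) * P z \<alpha>)"
          by (simp add: E_def T_def mono_at_P P_eq h_nth algebra_simps)
        also have "norm \<dots> \<le> norm (c \<alpha>) * (8 / r\<^sup>2 * r ^ \<alpha> i * (norm t)\<^sup>2 * norm (P z \<alpha>))"
          unfolding norm_mult[of "c \<alpha>"] norm_mult[of _ "P z \<alpha>"]
          using z r elim(2)
          by (intro mult_left_mono mult_right_mono norm_power_diff_quadratic) (auto simp: W_def h_nth)
        also have "\<dots> = 8 / r\<^sup>2 * (norm t)\<^sup>2 * (norm (c \<alpha>) * (norm (P z \<alpha>) * r ^ \<alpha> i))"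
          by simp
        also have "\<dots> \<le> 8 / r\<^sup>2 * (norm t)\<^sup>2 * (norm (c \<alpha>) * wt s \<alpha>)"
          using r by (intro mult_left_mono P_le z) auto
        finally show ?thesis .
      qed
      have "norm (g (?h t) + (- 1 * g z + - t * G z)) \<le> 8 / r\<^sup>2 * (norm t)\<^sup>2 * infsum (\<lambda>\<alpha>. norm (c \<alpha>) * wt s \<alpha>) UNIV"
      proof (rule norm_infsum_le[OF E])
        show "((\<lambda>\<alpha>. 8 / r\<^sup>2 * (norm t)\<^sup>2 * (norm (c \<alpha>) * wt s \<alpha>)) has_sum
            8 / r\<^sup>2 * (norm t)\<^sup>2 * infsum (\<lambda>\<alpha>. norm (c \<alpha>) * wt s \<alpha>) UNIV) UNIV"
          using s unfolding conv_at_def by (intro has_sum_cmult_right has_sum_infsum)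
      qed (rule E_le)
      also have "\<dots> = norm t * (B * norm t)"
        by (simp add: B_def power2_eq_square)
      also have "g (?h t) + (- 1 * g z + - t * G z) = t * ((g (?h t) - g z) / t - G z)"
        using elim(3) by (simp add: right_diff_distrib diff_divide_distrib)
      finally have "norm t * norm ((g (?h t) - g z) / t - G z) \<le> norm t * (B * norm t)"
        by (simp only: norm_mult)
      then show ?case
        using elim(3) by simp
    qed
    then have "((\<lambda>t. (g (?h t) - g z) / t - G z) \<longlongrightarrow> 0) (at 0)"
      by (rule Lim_null_comparison) (auto intro!: tendsto_eq_intros)
    then show ?thesis
      by (simp add: has_field_derivative_iff LIM_zero_iff)
  qed
  have pd_eq: "pd i g z = G z" if "z \<in> W" for z
    unfolding pd_def using der[OF that] by (rule DERIV_imp_deriv)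
  show "\<forall>\<^sub>F z in nhds 0. ((\<lambda>t. g (z + t *s axis i 1)) has_field_derivative pd i g z) (at 0)"
    using ev by eventually_elim (simp add: pd_eq der)
  show "represents (deriv_coeff i c) (pd i g)"
    unfolding represents_def using ev
  proof eventually_elim
    case (elim z)
    have "(T z has_sum G z) UNIV"
      by (rule T[OF elim])
    \<comment> \<open>Terms free of the variable \<open>i\<close> have derivative 0. On the others,
      lowering the \<open>i\<close>-th exponent is not truncated and is a bijection onto all
      exponents.\<close>
    also have "?this \<longleftrightarrow> (T z has_sum G z) {\<alpha>. 0 < \<alpha> i}"
      by (rule has_sum_cong_neutral) (auto simp: T_def)
    also have "\<dots> \<longleftrightarrow> ((\<lambda>\<alpha>. deriv_coeff i c \<alpha> * mono_at z \<alpha>) has_sum G z) UNIV"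
    proof (rule has_sum_reindex_bij_witness[of _ "\<lambda>\<alpha>. \<alpha> + unit_exp i" "\<lambda>\<alpha>. \<alpha> - unit_exp i"])
      fix \<alpha> :: "'n \<Rightarrow> nat"
      assume "\<alpha> \<in> {\<alpha>. 0 < \<alpha> i}"
      then have eq: "\<alpha> - unit_exp i + unit_exp i = \<alpha>"
        by (simp add: unit_exp_le_iff)
      then show "\<alpha> - unit_exp i + unit_exp i = \<alpha>" .
      have "P z (\<alpha> - unit_exp i) = P z \<alpha>"
        unfolding P_def by (intro prod.cong) (auto simp: unit_exp_def)
      moreover have "(\<alpha> - unit_exp i) i = \<alpha> i - 1"
        by (simp add: unit_exp_def)
      ultimately show "deriv_coeff i c (\<alpha> - unit_exp i) * mono_at z (\<alpha> - unit_exp i) = T z \<alpha>"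
        using \<open>\<alpha> \<in> _\<close> by (simp add: deriv_coeff_def eq T_def mono_at_P of_nat_diff)
    qed (auto simp: unit_exp_def)
    finally show ?case
      by (simp add: pd_eq[OF elim])
  qed
qed

section \<open>Division with remainder\<close>

text \<open>Monotone subsequences are extracted one coordinate after the other; a further
  subsequence keeps the monotonicity already obtained.\<close>

lemma exists_monotone_subseq:
  fixes x :: "nat \<Rightarrow> 'n::finite \<Rightarrow> nat"
  shows "\<exists>r :: nat \<Rightarrow> nat. strict_mono r \<and> (\<forall>i\<in>A. mono (\<lambda>n. x (r n) i))"
proof -
  have "finite A" by simp
  then show ?thesis
  proof induction
    case empty
    show ?case by (rule exI[of _ id]) (simp add: strict_mono_def)
  next
    case (insert a A)
    then obtain r :: "nat \<Rightarrow> nat" where r: "strict_mono r" "\<forall>i\<in>A. mono (\<lambda>n. x (r n) i)"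
      by blast
    obtain q where q: "strict_mono q" "monoseq (\<lambda>n. x (r (q n)) a)"
      using seq_monosub[of "\<lambda>n. x (r n) a"] by blast
    have "\<exists>p :: nat \<Rightarrow> nat. strict_mono p \<and> mono (\<lambda>n. x (r (q (p n))) a)"
    proof (cases "mono (\<lambda>n. x (r (q n)) a)")
      case True
      then show ?thesis by (intro exI[of _ id]) (simp add: strict_mono_def)
    next
      case False
      then have dec: "\<And>m n. m \<le> n \<Longrightarrow> x (r (q n)) a \<le> x (r (q m)) a"
        using q(2) by (auto simp: monoseq_def mono_def)
      \<comment> \<open>A nonincreasing sequence of naturals is constant from an index where its
        minimum is attained, so dropping the earlier terms makes it monotone.\<close>
      obtain k where k: "\<And>n. x (r (q k)) a \<le> x (r (q n)) a"
        using ex_has_least_nat[of "\<lambda>_. True" 0 "\<lambda>n. x (r (q n)) a"] by auto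
      have "x (r (q (n + k))) a = x (r (q k)) a" for n
        using k[of "n + k"] dec[of k "n + k"] by simp
      then show ?thesis
        by (intro exI[of _ "\<lambda>n. n + k"]) (simp add: strict_mono_def mono_def)
    qed
    then obtain p :: "nat \<Rightarrow> nat" where p: "strict_mono p" "mono (\<lambda>n. x (r (q (p n))) a)"
      by blast
    have "strict_mono (\<lambda>n. r (q (p n)))"
      using r(1) q(1) p(1) by (simp add: strict_mono_def)
    moreover have "mono (\<lambda>n. x (r (q (p n))) i)" if "i \<in> A" for i
      using r(2) that strict_mono_mono[OF q(1)] strict_mono_mono[OF p(1)] by (auto simp: mono_def)
    ultimately show ?case
      using p(2) by (intro exI[of _ "\<lambda>n. r (q (p n))"]) auto
  qed
qed

text \<open>The minimal elements of \<open>E\<close> suffice: below each element one of least degree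
  is minimal. Infinitely many minimal elements would contain a coordinatewise monotone sequence,
  hence two distinct comparable ones.\<close>

lemma dickson:
  fixes E :: "('n::finite \<Rightarrow> nat) set"
  shows "\<exists>F\<subseteq>E. finite F \<and> (\<forall>\<delta>\<in>E. \<exists>\<alpha>\<in>F. \<alpha> \<le> \<delta>)"
proof (intro exI conjI ballI)
  let ?F = "{\<alpha>\<in>E. \<forall>\<beta>\<in>E. \<beta> \<le> \<alpha> \<longrightarrow> \<beta> = \<alpha>}"
  show "?F \<subseteq> E" by blast
  show "finite ?F"
  proof (rule ccontr)
    assume "infinite ?F"
    then obtain x :: "nat \<Rightarrow> 'n \<Rightarrow> nat" where x: "inj x" "range x \<subseteq> ?F"
      by (auto dest: infinite_countable_subset)
    obtain r :: "nat \<Rightarrow> nat" where r: "strict_mono r" "\<forall>i\<in>UNIV. mono (\<lambda>n. x (r n) i)"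
      using exists_monotone_subseq by blast
    have "x (r 0) \<le> x (r 1)"
      using r(2) by (auto simp: le_fun_def mono_def)
    then have "x (r 0) = x (r 1)"
      using x(2) by blast
    then have "r 0 = r 1"
      using x(1) by (simp add: inj_eq)
    then show False
      using r(1) by (simp add: strict_mono_eq)
  qed
  fix \<delta> assume "\<delta> \<in> E"
  then obtain \<alpha> where \<alpha>: "\<alpha> \<in> E" "\<alpha> \<le> \<delta>" "\<And>\<beta>. \<beta> \<in> E \<and> \<beta> \<le> \<delta> \<Longrightarrow> deg \<alpha> \<le> deg \<beta>"
    using ex_has_least_nat[of "\<lambda>\<alpha>. \<alpha> \<in> E \<and> \<alpha> \<le> \<delta>" \<delta> deg] by auto
  have "\<beta> = \<alpha>" if "\<beta> \<in> E" "\<beta> \<le> \<alpha>" for \<beta>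
  proof -
    have "deg \<alpha> \<le> deg \<beta>"
      using \<alpha> that order_trans by blast
    moreover have "deg \<alpha> = deg \<beta> + deg (\<alpha> - \<beta>)"
      using that(2) by (metis deg_add exp_add_diff)
    ultimately have "\<alpha> - \<beta> = 0"
      using deg_eq_0_iff[of "\<alpha> - \<beta>"] by linarith
    then show ?thesis
      using exp_add_diff[OF that(2)] by simp
  qed
  with \<alpha> show "\<exists>\<alpha>\<in>?F. \<alpha> \<le> \<delta>" by blast
qed

text \<open>The equation is solved by recursion along \<open>N\<close>. Summability is a contraction
  argument: \<open>t\<close> has norm at most 1/2 on the weighted l1 space, so the solution has at
  most twice the norm of \<open>c\<close>.\<close>

lemma triangular_system_summable_solution:
  fixes N :: "'a \<Rightarrow> nat" and t :: "'a \<Rightarrow> 'a \<Rightarrow> complex" and w :: "'a \<Rightarrow> real"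
  assumes fin: "\<And>K. finite {a. N a \<le> K}"
    and w: "\<And>a. 0 \<le> w a"
    and col: "\<And>\<delta> G. finite G \<Longrightarrow> (\<Sum>\<gamma>\<in>G. norm (t \<delta> \<gamma>) * w \<gamma>) \<le> w \<delta> / 2"
    and c: "(\<lambda>\<gamma>. norm (c \<gamma>) * w \<gamma>) summable_on UNIV"
  shows "\<exists>v. (\<forall>\<gamma>. v \<gamma> = c \<gamma> - (\<Sum>\<delta> | N \<delta> < N \<gamma>. v \<delta> * t \<delta> \<gamma>)) \<and>
             (\<lambda>\<gamma>. norm (v \<gamma>) * w \<gamma>) summable_on UNIV"
proof -
  have "\<exists>v. \<forall>\<gamma>. v \<gamma> = c \<gamma> - (\<Sum>\<delta> | N \<delta> < N \<gamma>. v \<delta> * t \<delta> \<gamma>)"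
  proof (rule dependent_wf_choice[of "Wellfounded.measure N" "\<lambda>v \<gamma> x. x = c \<gamma> - (\<Sum>\<delta> | N \<delta> < N \<gamma>. v \<delta> * t \<delta> \<gamma>)"])
    fix f g :: "'a \<Rightarrow> complex" and \<gamma> and x :: complex
    assume "\<And>\<delta>. (\<delta>, \<gamma>) \<in> Wellfounded.measure N \<Longrightarrow> f \<delta> = g \<delta>"
    then have "(\<Sum>\<delta> | N \<delta> < N \<gamma>. f \<delta> * t \<delta> \<gamma>) = (\<Sum>\<delta> | N \<delta> < N \<gamma>. g \<delta> * t \<delta> \<gamma>)"
      by (intro sum.cong) auto
    then show "(x = c \<gamma> - (\<Sum>\<delta> | N \<delta> < N \<gamma>. f \<delta> * t \<delta> \<gamma>)) = (x = c \<gamma> - (\<Sum>\<delta> | N \<delta> < N \<gamma>. g \<delta> * t \<delta> \<gamma>))"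
      by simp
  qed auto
  then obtain v where v: "\<And>\<gamma>. v \<gamma> = c \<gamma> - (\<Sum>\<delta> | N \<delta> < N \<gamma>. v \<delta> * t \<delta> \<gamma>)"
    by blast
  define C where "C = (\<Sum>\<^sub>\<infinity>\<gamma>. norm (c \<gamma>) * w \<gamma>)"
  have bound: "(\<Sum>\<gamma> | N \<gamma> \<le> K. norm (v \<gamma>) * w \<gamma>) \<le> 2 * C" for K
  proof -
    let ?S = "{\<gamma>. N \<gamma> \<le> K}"
    have "(\<Sum>\<gamma>\<in>?S. norm (v \<gamma>) * w \<gamma>)
        \<le> (\<Sum>\<gamma>\<in>?S. norm (c \<gamma>) * w \<gamma> + (\<Sum>\<delta>\<in>?S. norm (v \<delta>) * (norm (t \<delta> \<gamma>) * w \<gamma>)))"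
    proof (rule sum_mono)
      fix \<gamma> assume "\<gamma> \<in> ?S"
      have "norm (\<Sum>\<delta> | N \<delta> < N \<gamma>. v \<delta> * t \<delta> \<gamma>) \<le> (\<Sum>\<delta> | N \<delta> < N \<gamma>. norm (v \<delta>) * norm (t \<delta> \<gamma>))"
        by (rule order_trans[OF norm_sum]) (simp add: norm_mult)
      also have "\<dots> \<le> (\<Sum>\<delta>\<in>?S. norm (v \<delta>) * norm (t \<delta> \<gamma>))"
        using \<open>\<gamma> \<in> ?S\<close> fin by (intro sum_mono2) auto
      finally have "norm (v \<gamma>) \<le> norm (c \<gamma>) + (\<Sum>\<delta>\<in>?S. norm (v \<delta>) * norm (t \<delta> \<gamma>))"
        by (subst v) (rule order_trans[OF norm_triangle_ineq4 add_left_mono])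
      then have "norm (v \<gamma>) * w \<gamma> \<le> (norm (c \<gamma>) + (\<Sum>\<delta>\<in>?S. norm (v \<delta>) * norm (t \<delta> \<gamma>))) * w \<gamma>"
        by (rule mult_right_mono[OF _ w])
      then show "norm (v \<gamma>) * w \<gamma> \<le> norm (c \<gamma>) * w \<gamma> + (\<Sum>\<delta>\<in>?S. norm (v \<delta>) * (norm (t \<delta> \<gamma>) * w \<gamma>))"
        by (simp only: distrib_right sum_distrib_right mult.assoc)
    qed
    also have "\<dots> = (\<Sum>\<gamma>\<in>?S. norm (c \<gamma>) * w \<gamma>) + (\<Sum>\<delta>\<in>?S. norm (v \<delta>) * (\<Sum>\<gamma>\<in>?S. norm (t \<delta> \<gamma>) * w \<gamma>))"
      unfolding sum.distrib by (subst sum.swap) (simp add: sum_distrib_left)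
    \<comment> \<open>With X for the weighted norm of \<open>v\<close> on \<open>?S\<close>, the
      column bound yields X \<le> C + X/2; X is finite because \<open>?S\<close> is.\<close>
    also have "\<dots> \<le> C + (\<Sum>\<delta>\<in>?S. norm (v \<delta>) * (w \<delta> / 2))"
      unfolding C_def using c w fin
      by (intro add_mono sum_mono mult_left_mono col finite_sum_le_infsum) auto
    also have "(\<Sum>\<delta>\<in>?S. norm (v \<delta>) * (w \<delta> / 2)) = (\<Sum>\<delta>\<in>?S. norm (v \<delta>) * w \<delta>) / 2"
      by (simp add: sum_divide_distrib)
    finally show ?thesis by simp
  qed
  have "(\<lambda>\<gamma>. norm (v \<gamma>) * w \<gamma>) summable_on UNIV"
  proof (rule nonneg_bdd_above_summable_on)
    show "bdd_above (sum (\<lambda>\<gamma>. norm (v \<gamma>) * w \<gamma>) ` {F. F \<subseteq> UNIV \<and> finite F})"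
    proof (rule bdd_aboveI2)
      fix F :: "'a set" assume F: "F \<in> {F. F \<subseteq> UNIV \<and> finite F}"
      have "(\<Sum>\<gamma>\<in>F. norm (v \<gamma>) * w \<gamma>) \<le> (\<Sum>\<gamma> | N \<gamma> \<le> (\<Sum>a\<in>F. N a). norm (v \<gamma>) * w \<gamma>)"
        using F w fin by (intro sum_mono2) (auto intro: member_le_sum)
      then show "(\<Sum>\<gamma>\<in>F. norm (v \<gamma>) * w \<gamma>) \<le> 2 * C"
        using bound order_trans by blast
    qed
  qed (use w in auto)
  with v show ?thesis by blast
qed

text \<open>The local convention of standard bases: the smallest exponent leads. Its coefficient is
  normalised to 1.\<close>

definition leads :: "(('n::finite \<Rightarrow> nat) \<Rightarrow> complex) \<Rightarrow> ('n \<Rightarrow> nat) \<Rightarrow> bool" where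
  "leads c \<alpha> \<longleftrightarrow> c \<alpha> = 1 \<and> (\<forall>\<beta>. enc \<beta> < enc \<alpha> \<longrightarrow> c \<beta> = 0)"

text \<open>Going from \<open>s0\<close> to \<open>s0 + k\<close> divides the weight of \<beta> by
  the \<open>k\<close>-th power of its code. All other exponents in the support have code at least
  \<open>A + 1\<close>, where \<open>A\<close> is the code of \<alpha>, so the tail shrinks relative
  to the leading weight like (A/(A+1))^k.\<close>

lemma eventually_tail_le:
  fixes c :: "('n::finite \<Rightarrow> nat) \<Rightarrow> complex"
  assumes "\<forall>\<^sub>F s in sequentially. conv_at s c" "leads c \<alpha>"
  shows "\<forall>\<^sub>F s in sequentially. \<forall>G. finite G \<longrightarrow> \<alpha> \<notin> G \<longrightarrow> (\<Sum>\<beta>\<in>G. norm (c \<beta>) * wt s \<beta>) \<le> wt s \<alpha> / 2"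
proof -
  obtain s0 where s0: "conv_at s0 c"
    using assms(1) by (meson eventually_sequentially order_refl)
  define C where "C = (\<Sum>\<^sub>\<infinity>\<beta>. norm (c \<beta>) * wt s0 \<beta>)"
  define A where "A = real (enc \<alpha>)"
  have A: "0 < A"
    by (simp add: A_def enc_pos)
  have "(\<lambda>k. C * (A / (A + 1)) ^ k) \<longlonglongrightarrow> C * 0"
    using A by (intro tendsto_intros LIMSEQ_power_zero) auto
  moreover have "C * 0 < wt s0 \<alpha> / 2"
    using wt_pos[of s0 \<alpha>] by simp
  ultimately have "\<forall>\<^sub>F k in sequentially. C * (A / (A + 1)) ^ k < wt s0 \<alpha> / 2"
    by (rule order_tendstoD)
  then obtain k0 where k0: "\<And>k. k0 \<le> k \<Longrightarrow> C * (A / (A + 1)) ^ k < wt s0 \<alpha> / 2"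
    by (auto simp: eventually_sequentially)
  show ?thesis
    unfolding eventually_sequentially
  proof (intro exI[of _ "s0 + k0"] allI impI)
    fix s and G :: "('n \<Rightarrow> nat) set"
    assume s: "s0 + k0 \<le> s" and G: "finite G" "\<alpha> \<notin> G"
    define k where "k = s - s0"
    have k: "s = s0 + k" "k0 \<le> k"
      using s by (auto simp: k_def)
    have wt_split: "wt s \<beta> = wt s0 \<beta> * (1 / real (enc \<beta>)) ^ k" for \<beta> :: "'n \<Rightarrow> nat"
      by (simp add: wt_eq k power_add power_one_over)
    have "(\<Sum>\<beta>\<in>G. norm (c \<beta>) * wt s \<beta>) \<le> (\<Sum>\<beta>\<in>G. norm (c \<beta>) * wt s0 \<beta> * (1 / (A + 1)) ^ k)"
    proof (rule sum_mono)
      fix \<beta> assume "\<beta> \<in> G"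
      show "norm (c \<beta>) * wt s \<beta> \<le> norm (c \<beta>) * wt s0 \<beta> * (1 / (A + 1)) ^ k"
      proof (cases "c \<beta> = 0")
        case False
        with assms(2) have "enc \<alpha> \<le> enc \<beta>"
          by (auto simp: leads_def not_less[symmetric])
        moreover have "enc \<alpha> \<noteq> enc \<beta>"
          using G \<open>\<beta> \<in> G\<close> inj_enc by (metis injD)
        ultimately have "A + 1 \<le> real (enc \<beta>)"
          by (simp add: A_def)
        then have "(1 / real (enc \<beta>)) ^ k \<le> (1 / (A + 1)) ^ k"
          using A by (intro power_mono divide_left_mono) auto
        then show ?thesis
          unfolding wt_split mult.assoc using wt_pos[of s0 \<beta>] by (intro mult_left_mono) auto
      qed simp
    qed
    also have "\<dots> = (\<Sum>\<beta>\<in>G. norm (c \<beta>) * wt s0 \<beta>) * (1 / (A + 1)) ^ k"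
      by (simp add: sum_distrib_right)
    also have "\<dots> \<le> C * (1 / (A + 1)) ^ k"
      unfolding C_def using s0 G A
      by (intro mult_right_mono finite_sum_le_infsum) (auto simp: conv_at_def)
    also have "\<dots> = (C * (A / (A + 1)) ^ k) * (1 / A) ^ k"
      using A by (simp add: power_divide)
    also have "\<dots> \<le> wt s0 \<alpha> / 2 * (1 / A) ^ k"
      using A k0[OF k(2)] by (intro mult_right_mono) auto
    also have "\<dots> = wt s \<alpha> / 2"
      by (simp add: wt_split A_def)
    finally show "(\<Sum>\<beta>\<in>G. norm (c \<beta>) * wt s \<beta>) \<le> wt s \<alpha> / 2" .
  qed
qed

text \<open>Each \<delta> in \<open>E\<close> is assigned one divisor \<open>lead \<delta>\<close>
  in \<open>F\<close>. The unknown \<open>v \<delta>\<close> is the multiple of the shifted divisor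
  with leading exponent \<delta> if \<delta> lies in \<open>E\<close>, and a remainder coefficient
  otherwise. Comparing coefficients gives a triangular system; for large \<open>s\<close> the tails
  of the divisors are small enough to solve it with convergence.\<close>

lemma division:
  fixes c :: "('n::finite \<Rightarrow> nat) \<Rightarrow> complex"
  assumes F: "finite F" "\<And>\<delta>. \<delta> \<in> E \<Longrightarrow> \<exists>\<alpha>\<in>F. \<alpha> \<le> \<delta>"
    and g: "\<And>\<alpha>. \<alpha> \<in> F \<Longrightarrow> leads (g \<alpha>) \<alpha>"
      "\<And>\<alpha>. \<alpha> \<in> F \<Longrightarrow> \<forall>\<^sub>F s in sequentially. conv_at s (g \<alpha>)"
    and c: "\<forall>\<^sub>F s in sequentially. conv_at s c"
  shows "\<exists>s q r. conv_at s r \<and> (\<forall>\<alpha>\<in>F. conv_at s (q \<alpha>)) \<and> (\<forall>\<delta>\<in>E. r \<delta> = 0) \<and>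
    (\<forall>\<gamma>. c \<gamma> = r \<gamma> + (\<Sum>\<alpha>\<in>F. cauchy_prod (q \<alpha>) (g \<alpha>) \<gamma>))"
proof -
  obtain lead where lead: "\<And>\<delta>. \<delta> \<in> E \<Longrightarrow> lead \<delta> \<in> F \<and> lead \<delta> \<le> \<delta>"
    using F(2) by metis
  have "\<forall>\<^sub>F s in sequentially. \<forall>\<alpha>\<in>F. \<forall>G. finite G \<longrightarrow> \<alpha> \<notin> G \<longrightarrow>
      (\<Sum>\<beta>\<in>G. norm (g \<alpha> \<beta>) * wt s \<beta>) \<le> wt s \<alpha> / 2"
    using F(1) g by (intro eventually_ball_finite ballI eventually_tail_le)
  from eventually_happens'[OF sequentially_bot eventually_conj[OF c this]] obtain s where s: "conv_at s c"
    "\<And>\<alpha> G. \<alpha> \<in> F \<Longrightarrow> finite G \<Longrightarrow> \<alpha> \<notin> G \<Longrightarrow> (\<Sum>\<beta>\<in>G. norm (g \<alpha> \<beta>) * wt s \<beta>) \<le> wt s \<alpha> / 2"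
    by blast
  \<comment> \<open>Row \<delta> holds the coefficients of the divisor
    \<open>g (lead \<delta>)\<close> shifted by \<open>\<delta> - lead \<delta>\<close>. The leading
    term is left out, since it accounts for \<open>v \<delta>\<close> itself.\<close>
  define t where "t \<delta> \<gamma> = (if \<delta> \<in> E \<and> \<gamma> \<noteq> \<delta> \<and> \<delta> - lead \<delta> \<le> \<gamma> then g (lead \<delta>) (\<gamma> - (\<delta> - lead \<delta>)) else 0)" for \<delta> \<gamma>
  have col: "(\<Sum>\<gamma>\<in>G. norm (t \<delta> \<gamma>) * wt s \<gamma>) \<le> wt s \<delta> / 2" if "finite G" for \<delta> G
  proof (cases "\<delta> \<in> E")
    case True
    define \<alpha> where "\<alpha> = lead \<delta>"
    define \<eta> where "\<eta> = \<delta> - \<alpha>"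
    have \<alpha>: "\<alpha> \<in> F" "\<delta> = \<alpha> + \<eta>"
      using lead[OF True] by (auto simp: \<alpha>_def \<eta>_def)
    define G' where "G' = {\<gamma>\<in>G. \<gamma> \<noteq> \<delta> \<and> \<eta> \<le> \<gamma>}"
    have "(\<Sum>\<gamma>\<in>G. norm (t \<delta> \<gamma>) * wt s \<gamma>) = (\<Sum>\<gamma>\<in>G'. norm (g \<alpha> (\<gamma> - \<eta>)) * (wt s (\<gamma> - \<eta>) * wt s \<eta>))"
      using that True unfolding G'_def
      by (intro sum.mono_neutral_cong_right) (auto simp: t_def \<alpha>_def \<eta>_def simp flip: wt_add)
    also have "\<dots> = (\<Sum>\<beta>\<in>(\<lambda>\<gamma>. \<gamma> - \<eta>) ` G'. norm (g \<alpha> \<beta>) * (wt s \<beta> * wt s \<eta>))"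
      by (subst sum.reindex[OF inj_on_inverseI[of _ "\<lambda>\<gamma>. \<gamma> + \<eta>"]]) (auto simp: G'_def)
    also have "\<dots> = (\<Sum>\<beta>\<in>(\<lambda>\<gamma>. \<gamma> - \<eta>) ` G'. norm (g \<alpha> \<beta>) * wt s \<beta>) * wt s \<eta>"
      by (simp add: sum_distrib_right mult.assoc)
    also have "\<dots> \<le> wt s \<alpha> / 2 * wt s \<eta>"
    proof (rule mult_right_mono[OF s(2)])
      show "\<alpha> \<notin> (\<lambda>\<gamma>. \<gamma> - \<eta>) ` G'"
        by (auto simp: G'_def \<alpha>(2))
    qed (use \<alpha> that wt_pos[of s \<eta>] in \<open>auto simp: G'_def\<close>)
    also have "\<dots> = wt s \<delta> / 2"
      by (simp add: \<alpha>(2) wt_add)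
    finally show ?thesis .
  next
    case False
    then show ?thesis
      using wt_pos[of s \<delta>] by (simp add: t_def)
  qed
  obtain v where v: "\<And>\<gamma>. v \<gamma> = c \<gamma> - (\<Sum>\<delta> | enc \<delta> < enc \<gamma>. v \<delta> * t \<delta> \<gamma>)"
      and v_sum: "(\<lambda>\<gamma>. norm (v \<gamma>) * wt s \<gamma>) summable_on UNIV"
    using triangular_system_summable_solution[of enc "wt s" t c, OF finite_enc_le wt_nonneg col] s(1)
    unfolding conv_at_def by blast
  \<comment> \<open>The solution is split: entries outside \<open>E\<close> form the remainder, and
    an entry at \<delta> in \<open>E\<close> becomes the coefficient of
    \<open>q (lead \<delta>)\<close> at \<open>\<delta> - lead \<delta>\<close>.\<close>
  define r where "r \<gamma> = (if \<gamma> \<in> E then 0 else v \<gamma>)" for \<gamma>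
  define q where "q \<alpha> \<beta> = (if \<beta> + \<alpha> \<in> E \<and> lead (\<beta> + \<alpha>) = \<alpha> then v (\<beta> + \<alpha>) else 0)" for \<alpha> \<beta>
  have "conv_at s r"
    unfolding conv_at_def using v_sum
    by (rule summable_on_comparison_test) (auto simp: r_def)
  moreover have "conv_at s (q \<alpha>)" for \<alpha>
  proof -
    have "(\<lambda>\<gamma>. norm (v \<gamma>) * wt s \<gamma>) summable_on range (\<lambda>\<beta>. \<beta> + \<alpha>)"
      using v_sum by (rule summable_on_subset_banach) auto
    then have "(\<lambda>\<beta>. norm (v (\<beta> + \<alpha>)) * wt s (\<beta> + \<alpha>)) summable_on UNIV"
      by (subst (asm) summable_on_reindex[OF inj_on_inverseI[of _ "\<lambda>\<gamma>. \<gamma> - \<alpha>"]]) (auto simp: o_def)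
    then have "(\<lambda>\<beta>. norm (v (\<beta> + \<alpha>)) * wt s (\<beta> + \<alpha>) * (1 / wt s \<alpha>)) summable_on UNIV"
      by (rule summable_on_cmult_left)
    then show ?thesis
      unfolding conv_at_def
      by (rule summable_on_comparison_test)
         (use wt_pos[of s \<alpha>] in \<open>auto simp: q_def wt_add\<close>)
  qed
  moreover have "c \<gamma> = r \<gamma> + (\<Sum>\<alpha>\<in>F. cauchy_prod (q \<alpha>) (g \<alpha>) \<gamma>)" for \<gamma>
  proof -
    define B where "B = {(\<alpha>, \<beta>). \<alpha> \<in> F \<and> \<beta> \<le> \<gamma> \<and> \<beta> + \<alpha> \<in> E \<and> lead (\<beta> + \<alpha>) = \<alpha>}"
    define \<Delta> where "\<Delta> = {\<delta>\<in>E. \<delta> - lead \<delta> \<le> \<gamma>}"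
    define T where "T \<delta> = v \<delta> * g (lead \<delta>) (\<gamma> - (\<delta> - lead \<delta>))" for \<delta>
    have finB: "finite B"
      by (rule finite_subset[OF _ finite_SigmaI[OF F(1) finite_exp_le[of \<gamma>]]]) (auto simp: B_def)
    have \<Delta>_B: "\<Delta> = (\<lambda>(\<alpha>, \<beta>). \<beta> + \<alpha>) ` B"
    proof (intro equalityI subsetI)
      fix \<delta> assume "\<delta> \<in> \<Delta>"
      then have "(lead \<delta>, \<delta> - lead \<delta>) \<in> B" "\<delta> - lead \<delta> + lead \<delta> = \<delta>"
        using lead by (auto simp: \<Delta>_def B_def)
      then show "\<delta> \<in> (\<lambda>(\<alpha>, \<beta>). \<beta> + \<alpha>) ` B"
        by (intro image_eqI[of _ _ "(lead \<delta>, \<delta> - lead \<delta>)"]) auto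
    qed (auto simp: \<Delta>_def B_def)
    have inj: "inj_on (\<lambda>(\<alpha>, \<beta>). \<beta> + \<alpha>) B"
      by (rule inj_on_inverseI[of _ "\<lambda>\<delta>. (lead \<delta>, \<delta> - lead \<delta>)"]) (auto simp: B_def)
    \<comment> \<open>A shifted divisor begins at its leading exponent \<delta>, because codes are
      multiplicative; it cannot contribute to a smaller exponent \<gamma>. Only the earlier
      exponents and \<gamma> itself remain, which matches the recursion for
      \<open>v\<close>.\<close>
    have T0: "T \<delta> = 0" if "\<delta> \<in> \<Delta>" "enc \<gamma> < enc \<delta>" for \<delta>
    proof -
      define \<eta> where "\<eta> = \<delta> - lead \<delta>"
      have eq: "lead \<delta> + \<eta> = \<delta>" "(\<gamma> - \<eta>) + \<eta> = \<gamma>" and "lead \<delta> \<in> F"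
        using that lead by (auto simp: \<Delta>_def \<eta>_def)
      have "enc (\<gamma> - \<eta>) * enc \<eta> < enc (lead \<delta>) * enc \<eta>"
        unfolding enc_add[symmetric] eq by (rule that(2))
      then have "enc (\<gamma> - \<eta>) < enc (lead \<delta>)"
        by simp
      then have "g (lead \<delta>) (\<gamma> - \<eta>) = 0"
        using g(1)[OF \<open>lead \<delta> \<in> F\<close>] by (simp add: leads_def)
      then show ?thesis
        by (simp add: T_def \<eta>_def)
    qed
    have "(\<Sum>\<alpha>\<in>F. cauchy_prod (q \<alpha>) (g \<alpha>) \<gamma>) = (\<Sum>(\<alpha>, \<beta>)\<in>F \<times> {\<beta>. \<beta> \<le> \<gamma>}. q \<alpha> \<beta> * g \<alpha> (\<gamma> - \<beta>))"
      unfolding cauchy_prod_def using F(1) finite_exp_le by (intro sum.Sigma) auto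
    also have "\<dots> = (\<Sum>(\<alpha>, \<beta>)\<in>B. T (\<beta> + \<alpha>))"
      using F(1) finite_exp_le[of \<gamma>]
      by (intro sum.mono_neutral_cong_right) (auto simp: B_def q_def T_def split: if_splits)
    also have "\<dots> = sum T \<Delta>"
      unfolding \<Delta>_B by (subst sum.reindex[OF inj]) (auto simp: o_def case_prod_beta)
    also have "\<dots> = sum T {\<delta>\<in>\<Delta>. enc \<delta> < enc \<gamma>} + sum T (\<Delta> \<inter> {\<gamma>})"
    proof -
      have "sum T \<Delta> = sum T ({\<delta>\<in>\<Delta>. enc \<delta> < enc \<gamma>} \<union> (\<Delta> \<inter> {\<gamma>}))"
      proof (rule sum.mono_neutral_right)
        show "finite \<Delta>"
          using finB \<Delta>_B by simp
        show "\<forall>\<delta>\<in>\<Delta> - ({\<delta> \<in> \<Delta>. enc \<delta> < enc \<gamma>} \<union> \<Delta> \<inter> {\<gamma>}). T \<delta> = 0"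
        proof
          fix \<delta> assume "\<delta> \<in> \<Delta> - ({\<delta> \<in> \<Delta>. enc \<delta> < enc \<gamma>} \<union> \<Delta> \<inter> {\<gamma>})"
          then have "\<delta> \<in> \<Delta>" "\<not> enc \<delta> < enc \<gamma>" "enc \<delta> \<noteq> enc \<gamma>"
            by (auto simp: inj_eq[OF inj_enc])
          then show "T \<delta> = 0"
            by (intro T0) auto
        qed
      qed auto
      also have "\<dots> = sum T {\<delta>\<in>\<Delta>. enc \<delta> < enc \<gamma>} + sum T (\<Delta> \<inter> {\<gamma>})"
        using finB \<Delta>_B by (intro sum.union_disjoint) auto
      finally show ?thesis .
    qed
    also have "sum T {\<delta>\<in>\<Delta>. enc \<delta> < enc \<gamma>} = (\<Sum>\<delta> | enc \<delta> < enc \<gamma>. v \<delta> * t \<delta> \<gamma>)"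
    proof (rule sum.mono_neutral_cong_left)
      show "finite {\<delta> :: 'n \<Rightarrow> nat. enc \<delta> < enc \<gamma>}"
        by (rule finite_subset[OF _ finite_enc_le[of "enc \<gamma>"]]) auto
    qed (auto simp: T_def t_def \<Delta>_def)
    also have "sum T (\<Delta> \<inter> {\<gamma>}) = (if \<gamma> \<in> E then v \<gamma> else 0)"
    proof (cases "\<gamma> \<in> E")
      case True
      have "\<gamma> - lead \<gamma> \<le> \<gamma>" "\<gamma> - (\<gamma> - lead \<gamma>) = lead \<gamma>"
        using lead[OF True] by (auto simp: le_fun_def fun_eq_iff)
      then show ?thesis
        using True lead[OF True] g(1)[of "lead \<gamma>"] by (auto simp: \<Delta>_def T_def leads_def)
    qed (auto simp: \<Delta>_def)
    finally show ?thesis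
      using v[of \<gamma>] by (auto simp: r_def)
  qed
  ultimately show ?thesis
    by (intro exI[of _ s] exI[of _ q] exI[of _ r]) (auto simp: r_def)
qed

section \<open>The ring of germs\<close>

lemma represents_coord: "represents (\<lambda>\<alpha>. if \<alpha> = unit_exp i then 1 else 0) (\<lambda>z. z $ i)"
  using represents_monomial[of "unit_exp i" 1] by simp

lemma cps_const: "cps (\<lambda>_. a)"
  using represents_monomial[of 0 a] by (auto simp: cps_iff_represents)

lemma cps_coord: "cps (\<lambda>z. z $ i)"
  using represents_monomial[of "unit_exp i" 1] by (auto simp: cps_iff_represents)

lemma cps_add: "cps g \<Longrightarrow> cps h \<Longrightarrow> cps (\<lambda>z. g z + h z)"
  using represents_add by (fastforce simp: cps_iff_represents)

lemma cps_mult: "cps g \<Longrightarrow> cps h \<Longrightarrow> cps (\<lambda>z. g z * h z)"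
  using represents_mult by (fastforce simp: cps_iff_represents)

lemma cps_cmult: "cps g \<Longrightarrow> cps (\<lambda>z. a * g z)"
  by (intro cps_mult cps_const)

lemma cps_uminus: "cps g \<Longrightarrow> cps (\<lambda>z. - g z)"
  using cps_cmult[of g "-1"] by simp

lemma cps_diff: "cps g \<Longrightarrow> cps h \<Longrightarrow> cps (\<lambda>z. g z - h z)"
  using cps_add[of g "\<lambda>z. - h z"] cps_uminus[of h] by simp

lemma cps_sum: "(\<And>x. x \<in> A \<Longrightarrow> cps (g x)) \<Longrightarrow> cps (\<lambda>z. \<Sum>x\<in>A. g x z)"
  using cps_add cps_const[of 0] by (induction A rule: infinite_finite_induct) auto

lemma cps_pd: "cps g \<Longrightarrow> cps (pd i g)"
  using represents_pd by (fastforce simp: cps_iff_represents)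

lemma cps_has_field_derivative:
  "cps g \<Longrightarrow> \<forall>\<^sub>F z in nhds 0. ((\<lambda>t. g (z + t *s axis i 1)) has_field_derivative pd i g z) (at 0)"
  using represents_has_field_derivative by (fastforce simp: cps_iff_represents)

text \<open>Agreement near 0 implies agreement near every point close to 0, so the derivatives along
  a line through such a point coincide.\<close>

lemma pd_cong:
  fixes g h :: "complex^'n::finite \<Rightarrow> complex"
  assumes "\<forall>\<^sub>F z in nhds 0. g z = h z"
  shows "\<forall>\<^sub>F z in nhds 0. pd i g z = pd i h z"
proof -
  from assms have "\<forall>\<^sub>F z in nhds 0. \<forall>\<^sub>F y in nhds z. g y = h y"
    by (simp add: eventually_eventually)
  then show ?thesis
  proof eventually_elim
    case (elim z)
    have "((\<lambda>t. z + t *s axis i 1) \<longlongrightarrow> z) (nhds 0)"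
      by (rule vec_tendstoI) (auto simp: axis_def intro!: tendsto_eq_intros filterlim_ident)
    then have "\<forall>\<^sub>F t in nhds 0. g (z + t *s axis i 1) = h (z + t *s axis i 1)"
      using elim by (rule eventually_compose_filterlim[rotated])
    then show ?case
      unfolding pd_def by (intro deriv_cong_ev) auto
  qed
qed

lemma pd_add:
  assumes "cps g" "cps h"
  shows "\<forall>\<^sub>F z in nhds 0. pd i (\<lambda>z. g z + h z) z = pd i g z + pd i h z"
  using cps_has_field_derivative[OF assms(1), of i] cps_has_field_derivative[OF assms(2), of i]
proof eventually_elim
  case (elim z)
  then show ?case
    unfolding pd_def[of i "\<lambda>z. g z + h z"] by (intro DERIV_imp_deriv DERIV_add)
qed

lemma pd_mult:
  fixes g h :: "complex^'n::finite \<Rightarrow> complex"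
  assumes "cps g" "cps h"
  shows "\<forall>\<^sub>F z in nhds 0. pd i (\<lambda>z. g z * h z) z = g z * pd i h z + h z * pd i g z"
  using cps_has_field_derivative[OF assms(1), of i] cps_has_field_derivative[OF assms(2), of i]
proof eventually_elim
  case (elim z)
  then have "((\<lambda>t. g (z + t *s axis i 1) * h (z + t *s axis i 1)) has_field_derivative
      (g z * pd i h z + h z * pd i g z)) (at 0)"
    by (auto intro!: derivative_eq_intros)
  then show ?case
    unfolding pd_def[of i "\<lambda>z. g z * h z"] by (rule DERIV_imp_deriv)
qed

lemma pd_const: "pd i (\<lambda>_. a) z = 0"
  by (simp add: pd_def)

lemma pd_coord: "pd i (\<lambda>z. z $ j) z = (if i = j then 1 else 0)"
  unfolding pd_def by (rule DERIV_imp_deriv) (auto simp: axis_def intro!: derivative_eq_intros)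

text \<open>Both mixed derivatives are represented by the same coefficients.\<close>

lemma pd_commute:
  assumes "cps g"
  shows "\<forall>\<^sub>F z in nhds 0. pd i (pd j g) z = pd j (pd i g) z"
proof -
  obtain c where c: "represents c g"
    using assms by (auto simp: cps_iff_represents)
  have "deriv_coeff i (deriv_coeff j c) = deriv_coeff j (deriv_coeff i c)"
    by (auto simp: deriv_coeff_def fun_eq_iff unit_exp_def add_ac mult_ac)
  then show ?thesis
    using represents_unique represents_pd[OF represents_pd[OF c]] by metis
qed

\<comment> \<open>The ring C{x} as a type of its own, so that ring arithmetic and spans apply. The
  quotient is partial: functions without a convergent expansion represent no germ.\<close>
quotient_type (overloaded) 'n germ = "complex^'n::finite \<Rightarrow> complex" / partial:
  "\<lambda>g h. cps g \<and> cps h \<and> (\<forall>\<^sub>F z in nhds 0. g z = h z)"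
  morphisms rep_germ germ_of
proof (rule part_equivpI)
  show "\<exists>g :: complex^'n::finite \<Rightarrow> complex. cps g \<and> cps g \<and> (\<forall>\<^sub>F z in nhds 0. g z = g z)"
    by (intro exI[of _ "\<lambda>_. 0"]) (simp add: cps_const)
  show "symp (\<lambda>g h :: complex^'n::finite \<Rightarrow> complex. cps g \<and> cps h \<and> (\<forall>\<^sub>F z in nhds 0. g z = h z))"
    by (auto simp: symp_def eq_commute)
  show "transp (\<lambda>g h :: complex^'n::finite \<Rightarrow> complex. cps g \<and> cps h \<and> (\<forall>\<^sub>F z in nhds 0. g z = h z))"
    unfolding transp_def by (auto elim: eventually_elim2)
qed

instantiation germ :: (finite) comm_ring_1
begin

lift_definition zero_germ :: "'a germ" is "\<lambda>_. 0" by (simp add: cps_const)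
lift_definition one_germ :: "'a germ" is "\<lambda>_. 1" by (simp add: cps_const)
lift_definition plus_germ :: "'a germ \<Rightarrow> 'a germ \<Rightarrow> 'a germ" is "\<lambda>g h z. g z + h z"
  by (auto simp: cps_add elim: eventually_elim2)
lift_definition minus_germ :: "'a germ \<Rightarrow> 'a germ \<Rightarrow> 'a germ" is "\<lambda>g h z. g z - h z"
  by (auto simp: cps_diff elim: eventually_elim2)
lift_definition uminus_germ :: "'a germ \<Rightarrow> 'a germ" is "\<lambda>g z. - g z"
  by (auto simp: cps_uminus)
lift_definition times_germ :: "'a germ \<Rightarrow> 'a germ \<Rightarrow> 'a germ" is "\<lambda>g h z. g z * h z"
  by (auto simp: cps_mult elim: eventually_elim2)

instance
proof
  show "(0 :: 'a germ) \<noteq> 1"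
    by transfer (auto dest: eventually_nhds_x_imp_x)
qed (transfer; simp add: cps_add cps_mult cps_uminus cps_diff cps_const algebra_simps)+

end

lift_definition germ_const :: "complex \<Rightarrow> 'n::finite germ" is "\<lambda>a _. a"
  by (simp add: cps_const)

lift_definition germ_coord :: "'n::finite \<Rightarrow> 'n germ" is "\<lambda>i z. z $ i"
  by (simp add: cps_coord)

lift_definition germ_pd :: "'n::finite \<Rightarrow> 'n germ \<Rightarrow> 'n germ" is pd
  by (simp add: cps_pd pd_cong)

lift_definition germ_at_0 :: "'n::finite germ \<Rightarrow> complex" is "\<lambda>g. g 0"
  by (auto dest: eventually_nhds_x_imp_x)

lift_definition series_of :: "(('n::finite \<Rightarrow> nat) \<Rightarrow> complex) \<Rightarrow> 'n germ \<Rightarrow> bool" is represents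
  by (auto intro: represents_cong simp: eq_commute)

lemma germ_at_0_simps [simp]:
  "germ_at_0 0 = 0" "germ_at_0 1 = 1" "germ_at_0 (g + h) = germ_at_0 g + germ_at_0 h"
  "germ_at_0 (g - h) = germ_at_0 g - germ_at_0 h" "germ_at_0 (g * h) = germ_at_0 g * germ_at_0 h"
  "germ_at_0 (germ_const a) = a" "germ_at_0 (germ_coord i) = 0" "germ_at_0 (- g) = - germ_at_0 g"
  by (transfer; simp)+

lemma germ_at_0_sum [simp]: "germ_at_0 (sum g A) = (\<Sum>x\<in>A. germ_at_0 (g x))"
  by (induction A rule: infinite_finite_induct) auto

lemma germ_const_simps [simp]:
  "germ_const 0 = 0" "germ_const 1 = 1"
  "germ_const (a + b) = germ_const a + germ_const b" "germ_const (a * b) = germ_const a * germ_const b"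
  "germ_const (- a) = - germ_const a" "germ_const (a - b) = germ_const a - germ_const b"
  by (transfer; simp add: cps_const)+

lemma germ_const_sum [simp]: "germ_const (sum f A) = (\<Sum>x\<in>A. germ_const (f x))"
  by (induction A rule: infinite_finite_induct) auto

lemma germ_pd_simps [simp]:
  "germ_pd i (g + h) = germ_pd i g + germ_pd i h"
  "germ_pd i (germ_const a) = 0"
  "germ_pd i (germ_coord j) = (if i = j then 1 else 0)"
  by (transfer; simp add: pd_add cps_pd cps_add pd_const pd_coord cps_const cps_coord)+

lemma germ_pd_mult: "germ_pd i (g * h) = g * germ_pd i h + h * germ_pd i g"
  by (transfer; simp add: pd_mult cps_pd cps_add cps_mult)+

lemma germ_pd_commute: "germ_pd i (germ_pd j g) = germ_pd j (germ_pd i g)"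
  by (transfer; simp add: pd_commute cps_pd)

lemma germ_pd_zero [simp]: "germ_pd i 0 = 0"
  using germ_pd_simps(2)[of i 0] by simp

lemma germ_pd_uminus [simp]: "germ_pd i (- g) = - germ_pd i g"
  using germ_pd_simps(1)[of i g "- g"] by (simp add: eq_neg_iff_add_eq_0 add.commute)

lemma germ_pd_diff [simp]: "germ_pd i (g - h) = germ_pd i g - germ_pd i h"
  using germ_pd_simps(1)[of i g "- h"] by simp

lemma germ_pd_sum [simp]: "germ_pd i (sum g A) = (\<Sum>x\<in>A. germ_pd i (g x))"
  by (induction A rule: infinite_finite_induct) auto

lemma germ_pd_cmult [simp]: "germ_pd i (germ_const a * g) = germ_const a * germ_pd i g"
  by (simp add: germ_pd_mult)

lemma ex_series_of: "\<exists>c. series_of c g"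
  by transfer (simp add: cps_iff_represents)

lemma series_of_unique: "series_of c g \<Longrightarrow> series_of c h \<Longrightarrow> g = h"
  by transfer (auto intro: represents_unique)

lemma series_of_conv_at: "series_of c g \<Longrightarrow> \<forall>\<^sub>F s in sequentially. conv_at s c"
  by transfer (auto intro: represents_conv_at)

lemma conv_at_series_of: "conv_at s c \<Longrightarrow> \<exists>g. series_of c g"
proof -
  assume "conv_at s c"
  then obtain g where "represents c g"
    using conv_at_represents by blast
  then have "series_of c (germ_of g)"
    by (subst series_of.abs_eq) (auto simp: eq_onp_def cps_iff_represents)
  then show ?thesis ..
qed

lemma series_of_add: "series_of c g \<Longrightarrow> series_of d h \<Longrightarrow> series_of (\<lambda>\<alpha>. c \<alpha> + d \<alpha>) (g + h)"
  by transfer (rule represents_add)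

lemma series_of_cmult: "series_of c g \<Longrightarrow> series_of (\<lambda>\<alpha>. a * c \<alpha>) (germ_const a * g)"
  by transfer (rule represents_cmult)

lemma series_of_uminus: "series_of c g \<Longrightarrow> series_of (\<lambda>\<alpha>. - c \<alpha>) (- g)"
  using series_of_cmult[of c g "-1"] by simp

lemma series_of_diff: "series_of c g \<Longrightarrow> series_of d h \<Longrightarrow> series_of (\<lambda>\<alpha>. c \<alpha> - d \<alpha>) (g - h)"
  using series_of_add[of c g "\<lambda>\<alpha>. - d \<alpha>" "- h"] series_of_uminus[of d h] by simp

lemma series_of_mult: "series_of c g \<Longrightarrow> series_of d h \<Longrightarrow> series_of (cauchy_prod c d) (g * h)"
  by transfer (rule represents_mult)

lemma series_of_zero: "series_of (\<lambda>_. 0) 0"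
  by transfer (simp add: represents_def)

lemma series_of_sum:
  "(\<And>x. x \<in> A \<Longrightarrow> series_of (c x) (g x)) \<Longrightarrow> series_of (\<lambda>\<alpha>. \<Sum>x\<in>A. c x \<alpha>) (sum g A)"
proof (induction A rule: infinite_finite_induct)
  case (insert x F)
  then show ?case
    using series_of_add[of "c x" "g x" "\<lambda>\<alpha>. \<Sum>x\<in>F. c x \<alpha>" "sum g F"] by simp
qed (simp_all add: series_of_zero)

lemma series_of_pd: "series_of c g \<Longrightarrow> series_of (deriv_coeff i c) (germ_pd i g)"
  by transfer (rule represents_pd)

lemma series_of_at_0: "series_of c g \<Longrightarrow> c 0 = germ_at_0 g"
  by transfer (rule represents_at_0)

lemma series_of_coord: "series_of (\<lambda>\<alpha>. if \<alpha> = unit_exp i then 1 else 0) (germ_coord i)"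
  by transfer (rule represents_coord)

section \<open>Krull's intersection theorem\<close>

text \<open>The power m^k of the maximal ideal in terms of coefficients;
  \<open>ord_ge_Suc_decompose\<close> recovers the description by generators.\<close>

definition ord_ge :: "nat \<Rightarrow> 'n::finite germ set" where
  "ord_ge k = {g. \<exists>c. series_of c g \<and> (\<forall>\<alpha>. deg \<alpha> < k \<longrightarrow> c \<alpha> = 0)}"

lemma ord_geI: "series_of c g \<Longrightarrow> (\<And>\<alpha>. deg \<alpha> < k \<Longrightarrow> c \<alpha> = 0) \<Longrightarrow> g \<in> ord_ge k"
  by (auto simp: ord_ge_def)

lemma ord_geE:
  assumes "g \<in> ord_ge k"
  obtains c where "series_of c g" "\<And>\<alpha>. deg \<alpha> < k \<Longrightarrow> c \<alpha> = 0"
  using assms by (auto simp: ord_ge_def)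

lemma ord_ge_0 [simp]: "g \<in> ord_ge 0"
  using ex_series_of by (auto simp: ord_ge_def)

lemma zero_in_ord_ge [simp]: "0 \<in> ord_ge k"
  by (rule ord_geI[OF series_of_zero]) simp

lemma ord_ge_add: "g \<in> ord_ge k \<Longrightarrow> h \<in> ord_ge k \<Longrightarrow> g + h \<in> ord_ge k"
  by (elim ord_geE) (rule ord_geI, erule (1) series_of_add, simp)

lemma ord_ge_diff: "g \<in> ord_ge k \<Longrightarrow> h \<in> ord_ge k \<Longrightarrow> g - h \<in> ord_ge k"
  by (elim ord_geE) (rule ord_geI, erule (1) series_of_diff, simp)

lemma ord_ge_sum: "(\<And>x. x \<in> A \<Longrightarrow> g x \<in> ord_ge k) \<Longrightarrow> sum g A \<in> ord_ge k"
  by (induction A rule: infinite_finite_induct) (auto simp: ord_ge_add)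

lemma ord_ge_mult:
  assumes "g \<in> ord_ge k" "h \<in> ord_ge l"
  shows "g * h \<in> ord_ge (k + l)"
proof -
  obtain c d where c: "series_of c g" "\<And>\<alpha>. deg \<alpha> < k \<Longrightarrow> c \<alpha> = 0"
      and d: "series_of d h" "\<And>\<alpha>. deg \<alpha> < l \<Longrightarrow> d \<alpha> = 0"
    using assms by (auto elim!: ord_geE)
  show ?thesis
  proof (rule ord_geI[OF series_of_mult[OF c(1) d(1)]])
    fix \<gamma> :: "'a \<Rightarrow> nat" assume \<gamma>: "deg \<gamma> < k + l"
    have "c \<beta> * d (\<gamma> - \<beta>) = 0" if "\<beta> \<le> \<gamma>" for \<beta>
    proof -
      have "deg \<beta> + deg (\<gamma> - \<beta>) = deg \<gamma>"
        using that by (simp flip: deg_add)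
      with \<gamma> have "deg \<beta> < k \<or> deg (\<gamma> - \<beta>) < l"
        by linarith
      then show ?thesis
        using c(2) d(2) by auto
    qed
    then show "cauchy_prod c d \<gamma> = 0"
      by (auto simp: cauchy_prod_def intro!: sum.neutral)
  qed
qed

lemma ord_ge_mult_left: "g \<in> ord_ge k \<Longrightarrow> h * g \<in> ord_ge k"
  using ord_ge_mult[of h 0 g k] by simp

lemma ord_ge_mult_right: "g \<in> ord_ge k \<Longrightarrow> g * h \<in> ord_ge k"
  using ord_ge_mult_left[of g k h] by (simp add: mult.commute)

lemma ord_ge_pd: "g \<in> ord_ge (Suc k) \<Longrightarrow> germ_pd i g \<in> ord_ge k"
  by (elim ord_geE, rule ord_geI[OF series_of_pd]) (auto simp: deriv_coeff_def deg_add)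

lemma ord_ge_1_iff: "g \<in> ord_ge 1 \<longleftrightarrow> germ_at_0 g = 0"
proof -
  obtain c where c: "series_of c g"
    using ex_series_of by blast
  then show ?thesis
    using series_of_at_0 by (fastforce simp: ord_ge_def)
qed

lemma germ_coord_ord_ge [simp]: "germ_coord i \<in> ord_ge (Suc 0)"
  using ord_ge_1_iff by fastforce

text \<open>Every exponent other than 0 is assigned to one variable occurring in it, and its
  monomial is divided by that variable. Division by a variable scales all weights by a constant, so
  convergence is kept.\<close>

lemma ord_ge_Suc_decompose:
  fixes g :: "'n::finite germ"
  assumes "g \<in> ord_ge (Suc k)"
  shows "\<exists>b. (\<forall>i. b i \<in> ord_ge k) \<and> g = (\<Sum>i\<in>UNIV. germ_coord i * b i)"
proof -
  obtain c where c: "series_of c g" "\<And>\<alpha>. deg \<alpha> < Suc k \<Longrightarrow> c \<alpha> = 0"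
    using assms by (auto elim: ord_geE)
  obtain s where s: "conv_at s c"
    using eventually_happens'[OF sequentially_bot series_of_conv_at[OF c(1)]] by blast
  have "\<exists>j. \<alpha> \<noteq> 0 \<longrightarrow> 0 < \<alpha> j" for \<alpha> :: "'n \<Rightarrow> nat"
    by (auto simp: fun_eq_iff)
  then obtain idx where idx: "\<And>\<alpha> :: 'n \<Rightarrow> nat. \<alpha> \<noteq> 0 \<Longrightarrow> 0 < \<alpha> (idx \<alpha>)"
    by metis
  define b where "b i \<beta> = (if idx (\<beta> + unit_exp i) = i then c (\<beta> + unit_exp i) else 0)" for i \<beta>
  have "\<exists>h. series_of (b i) h" for i
  proof (rule conv_at_series_of)
    have "(\<lambda>\<gamma>. norm (c \<gamma>) * wt s \<gamma>) summable_on range (\<lambda>\<beta>. \<beta> + unit_exp i)"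
      using s unfolding conv_at_def by (rule summable_on_subset_banach) auto
    then have "(\<lambda>\<beta>. norm (c (\<beta> + unit_exp i)) * wt s (\<beta> + unit_exp i)) summable_on UNIV"
      by (subst (asm) summable_on_reindex[OF inj_on_inverseI[of _ "\<lambda>\<gamma>. \<gamma> - unit_exp i"]]) (auto simp: o_def)
    then have "(\<lambda>\<beta>. norm (c (\<beta> + unit_exp i)) * wt s (\<beta> + unit_exp i) * (1 / wt s (unit_exp i))) summable_on UNIV"
      by (rule summable_on_cmult_left)
    then show "conv_at s (b i)"
      unfolding conv_at_def
      by (rule summable_on_comparison_test)
         (use wt_pos[of s "unit_exp i"] in \<open>auto simp: b_def wt_add\<close>)
  qed
  then obtain h where h: "\<And>i. series_of (b i) (h i)"
    by metis
  have coord: "cauchy_prod (\<lambda>\<alpha>. if \<alpha> = unit_exp i then 1 else 0) d \<gamma> = (if unit_exp i \<le> \<gamma> then d (\<gamma> - unit_exp i) else 0)"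
    for i d and \<gamma> :: "'n \<Rightarrow> nat"
    unfolding cauchy_prod_def by (simp add: finite_exp_le if_distrib[of "\<lambda>x. x * _"] cong: if_cong)
  have "(\<Sum>i\<in>UNIV. if unit_exp i \<le> \<gamma> then b i (\<gamma> - unit_exp i) else 0) = c \<gamma>" for \<gamma>
  proof (cases "\<gamma> = 0")
    case True
    have "\<not> unit_exp i \<le> (0 :: 'n \<Rightarrow> nat)" for i
      by (subst unit_exp_le_iff) simp
    then show ?thesis
      using c(2)[of 0] by (simp add: True deg_eq_0_iff[THEN iffD2])
  next
    case False
    have "(if unit_exp i \<le> \<gamma> then b i (\<gamma> - unit_exp i) else 0) = (if i = idx \<gamma> then c \<gamma> else 0)" for i
      using idx[OF False] by (auto simp: b_def unit_exp_le_iff)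
    then show ?thesis by simp
  qed
  then have "series_of c (\<Sum>i\<in>UNIV. germ_coord i * h i)"
    using series_of_sum[of UNIV _ "\<lambda>i. germ_coord i * h i", OF series_of_mult[OF series_of_coord h]]
    by (simp add: coord)
  then have "g = (\<Sum>i\<in>UNIV. germ_coord i * h i)"
    by (rule series_of_unique[OF c(1)])
  moreover have "h i \<in> ord_ge k" for i
    by (rule ord_geI[OF h]) (auto simp: b_def deg_add intro!: c(2))
  ultimately show ?thesis
    by blast
qed

section \<open>Ideals of germs, Krull's theorem and Nakayama's lemma\<close>

lemma module_times: "module ((*) :: 'a::comm_ring_1 \<Rightarrow> 'a \<Rightarrow> 'a)"
  by unfold_locales (simp_all add: algebra_simps)

text \<open>The ring is a module over itself and ideals are its submodules, so closure rules and
  induction come from the theory of spans.\<close>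

abbreviation ideal :: "'a::comm_ring_1 set \<Rightarrow> 'a set" where
  "ideal \<equiv> module.span (*)"

lemmas ideal_add = module.span_add[OF module_times]
  and ideal_diff = module.span_diff[OF module_times]
  and ideal_neg = module.span_neg[OF module_times]
  and ideal_sum = module.span_sum[OF module_times]
  and ideal_mult = module.span_scale[OF module_times]
  and ideal_zero = module.span_zero[OF module_times]
  and ideal_base = module.span_base[OF module_times]
  and ideal_mono = module.span_mono[OF module_times]
  and ideal_explicit = module.span_explicit[OF module_times]
  and ideal_induct [consumes 1, case_names base step] = module.span_induct_alt[OF module_times]

text \<open>The remainder \<open>r\<close> of \<open>f\<close> has no exponent that leads an element of the ideal, but if \<open>r \<noteq> 0\<close>
  then \<open>r\<close> agrees up to its leading exponent with an element of the ideal.\<close>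

theorem krull_intersection:
  fixes f :: "'n::finite germ"
  assumes "\<And>k. \<exists>h\<in>ideal S. f - h \<in> ord_ge k"
  shows "f \<in> ideal S"
proof -
  define E where "E = {\<alpha>. \<exists>c h. series_of c h \<and> h \<in> ideal S \<and> leads c \<alpha>}"
  obtain F where F: "F \<subseteq> E" "finite F" "\<And>\<delta>. \<delta> \<in> E \<Longrightarrow> \<exists>\<alpha>\<in>F. \<alpha> \<le> \<delta>"
    using dickson[of E] by blast
  then have "\<forall>\<alpha>\<in>F. \<exists>c h. series_of c h \<and> h \<in> ideal S \<and> leads c \<alpha>"
    by (auto simp: E_def)
  \<comment> \<open>A standard basis of the ideal: every leading exponent of the ideal dominates one
    of theirs.\<close>
  then obtain g h where g: "\<And>\<alpha>. \<alpha> \<in> F \<Longrightarrow> series_of (g \<alpha>) (h \<alpha>)"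
      "\<And>\<alpha>. \<alpha> \<in> F \<Longrightarrow> h \<alpha> \<in> ideal S" "\<And>\<alpha>. \<alpha> \<in> F \<Longrightarrow> leads (g \<alpha>) \<alpha>"
    by metis
  obtain c where c: "series_of c f"
    using ex_series_of by blast
  obtain s q r where r: "conv_at s r" "\<forall>\<alpha>\<in>F. conv_at s (q \<alpha>)" "\<forall>\<delta>\<in>E. r \<delta> = 0"
      "\<forall>\<gamma>. c \<gamma> = r \<gamma> + (\<Sum>\<alpha>\<in>F. cauchy_prod (q \<alpha>) (g \<alpha>) \<gamma>)"
    using division[OF F(2,3) g(3) series_of_conv_at[OF g(1)] series_of_conv_at[OF c]] by blast
  obtain R where R: "series_of r R"
    using conv_at_series_of[OF r(1)] by blast
  have "\<forall>\<alpha>\<in>F. \<exists>Q. series_of (q \<alpha>) Q"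
    using r(2) conv_at_series_of by blast
  then obtain Q where Q: "\<And>\<alpha>. \<alpha> \<in> F \<Longrightarrow> series_of (q \<alpha>) (Q \<alpha>)"
    by metis
  have "series_of (\<lambda>\<gamma>. r \<gamma> + (\<Sum>\<alpha>\<in>F. cauchy_prod (q \<alpha>) (g \<alpha>) \<gamma>)) (R + (\<Sum>\<alpha>\<in>F. Q \<alpha> * h \<alpha>))"
    using R Q g by (intro series_of_add series_of_sum series_of_mult)
  moreover have "c = (\<lambda>\<gamma>. r \<gamma> + (\<Sum>\<alpha>\<in>F. cauchy_prod (q \<alpha>) (g \<alpha>) \<gamma>))"
    using r(4) by auto
  ultimately have f: "f = R + (\<Sum>\<alpha>\<in>F. Q \<alpha> * h \<alpha>)"
    using series_of_unique c by metis
  have sum_in: "(\<Sum>\<alpha>\<in>F. Q \<alpha> * h \<alpha>) \<in> ideal S"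
    by (intro ideal_sum ideal_mult g)
  have "r \<gamma> = 0" for \<gamma>
  proof (rule ccontr)
    assume "r \<gamma> \<noteq> 0"
    then obtain \<rho> where \<rho>: "r \<rho> \<noteq> 0" "\<And>\<beta>. r \<beta> \<noteq> 0 \<Longrightarrow> enc \<rho> \<le> enc \<beta>"
      using ex_has_least_nat[of "\<lambda>\<beta>. r \<beta> \<noteq> 0" \<gamma> enc] by blast
    \<comment> \<open>The order is the code of \<open>\<rho>\<close>: as degrees are smaller than
      codes, \<open>f - u\<close> has no terms at \<open>\<rho>\<close> or at smaller codes, so
      subtracting it leaves the lowest term of \<open>r\<close> intact.\<close>
    obtain u where u: "u \<in> ideal S" "f - u \<in> ord_ge (enc \<rho>)"
      using assms by blast
    then obtain d where d: "series_of d (f - u)" "\<And>\<alpha>. deg \<alpha> < enc \<rho> \<Longrightarrow> d \<alpha> = 0"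
      by (auto elim: ord_geE)
    have d0: "d \<beta> = 0" if "enc \<beta> \<le> enc \<rho>" for \<beta>
      using d(2) deg_less_enc[of \<beta>] that by simp
    let ?a = "1 / r \<rho>"
    \<comment> \<open>Here \<open>R - (f - u)\<close> is \<open>u\<close> minus the quotient part of
      \<open>f\<close>, a difference of two elements of the ideal.\<close>
    have "germ_const ?a * (R - (f - u)) \<in> ideal S"
      using ideal_diff[OF u(1) sum_in] by (intro ideal_mult) (simp add: f algebra_simps)
    moreover have "leads (\<lambda>\<beta>. ?a * (r \<beta> - d \<beta>)) \<rho>"
      using \<rho> d0 by (auto simp: leads_def not_le[symmetric])
    moreover have "series_of (\<lambda>\<beta>. ?a * (r \<beta> - d \<beta>)) (germ_const ?a * (R - (f - u)))"
      by (intro series_of_cmult series_of_diff R d)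
    ultimately have "\<rho> \<in> E"
      unfolding E_def by blast
    with r(3) \<rho>(1) show False by blast
  qed
  then have "r = (\<lambda>_. 0)" by auto
  then have "R = 0"
    using series_of_unique R series_of_zero by metis
  then show ?thesis
    using f sum_in by simp
qed

text \<open>Iterating the congruence of \<open>e\<close> with \<open>g * e\<close> gives
  \<open>e\<close> congruent to an element of m^k for every \<open>k\<close>, and Krull's theorem
  applies. This replaces inverting the unit \<open>1 - g\<close>.\<close>

lemma nakayama:
  fixes e :: "'n::finite germ"
  assumes "e - g * e \<in> ideal T" "g \<in> ord_ge 1"
  shows "e \<in> ideal T"
proof (rule krull_intersection)
  fix k
  have "\<exists>g'\<in>ord_ge k. e - g' * e \<in> ideal T"
  proof (induction k)
    case 0
    show ?case by (intro bexI[of _ 1]) (simp_all add: ideal_zero)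
  next
    case (Suc k)
    then obtain g' where g': "g' \<in> ord_ge k" "e - g' * e \<in> ideal T"
      by (rule bexE)
    have "e - (g' * g) * e = (e - g' * e) + g' * (e - g * e)"
      by (simp add: algebra_simps)
    also have "\<dots> \<in> ideal T"
      by (intro ideal_add ideal_mult g' assms)
    finally show ?case
      using ord_ge_mult[OF g'(1) assms(2)] by (intro bexI[of _ "g' * g"]) simp_all
  qed
  then obtain g' where "g' \<in> ord_ge k" "e - g' * e \<in> ideal T"
    by (rule bexE)
  then show "\<exists>h\<in>ideal T. e - h \<in> ord_ge k"
    by (intro bexI[of _ "e - g' * e"]) (simp_all add: ord_ge_mult_right)
qed

section \<open>Vector fields\<close>

definition vf :: "('n::finite \<Rightarrow> 'n germ) \<Rightarrow> 'n germ \<Rightarrow> 'n germ" where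
  "vf a g = (\<Sum>i\<in>UNIV. a i * germ_pd i g)"

lemma vf_add: "vf a (g + h) = vf a g + vf a h"
  by (simp add: vf_def distrib_left sum.distrib)

lemma vf_diff: "vf a (g - h) = vf a g - vf a h"
  by (simp add: vf_def right_diff_distrib sum_subtractf)

lemma vf_mult: "vf a (g * h) = g * vf a h + h * vf a g"
  by (simp add: vf_def germ_pd_mult algebra_simps sum.distrib sum_distrib_left)

lemma vf_const: "vf a (germ_const c) = 0"
  by (simp add: vf_def)

lemma vf_cmult: "vf a (germ_const c * g) = germ_const c * vf a g"
  by (simp add: vf_mult vf_const)

lemma vf_coord: "vf a (germ_coord i) = a i"
  by (simp add: vf_def if_distrib[of "\<lambda>x. _ * x"] cong: if_cong)

lemma vf_add_coeff: "vf (\<lambda>i. a i + b i) g = vf a g + vf b g"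
  by (simp add: vf_def distrib_right sum.distrib)

text \<open>The commutator of a partial derivative with a vector field is the field with
  differentiated coefficients.\<close>

lemma germ_pd_vf: "germ_pd j (vf a g) = vf a (germ_pd j g) + vf (\<lambda>i. germ_pd j (a i)) g"
  by (simp add: vf_def germ_pd_mult sum.distrib germ_pd_commute[of j] mult.commute)

text \<open>Differentiation loses one order, and a coefficient in m restores it.\<close>

lemma vf_ord_ge:
  assumes "\<And>i. a i \<in> ord_ge 1" "g \<in> ord_ge k"
  shows "vf a g \<in> ord_ge k"
proof (cases k)
  case (Suc l)
  have "a i * germ_pd i g \<in> ord_ge (1 + l)" for i
    using assms Suc by (intro ord_ge_mult ord_ge_pd) auto
  then show ?thesis
    unfolding vf_def Suc by (intro ord_ge_sum) auto
qed simp

section \<open>Derivations modulo an ideal as vector fields\<close>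

definition derivation_mod :: "'n::finite germ set \<Rightarrow> ('n germ \<Rightarrow> 'n germ) \<Rightarrow> bool" where
  "derivation_mod I D \<longleftrightarrow>
     (\<forall>g h. D (g + h) - (D g + D h) \<in> I) \<and>
     (\<forall>c g. D (germ_const c * g) - germ_const c * D g \<in> I) \<and>
     (\<forall>g h. D (g * h) - (g * D h + h * D g) \<in> I)"

text \<open>The difference of the two derivations kills the coordinates, hence by Leibniz has values in
  \<open>I + m\<^sup>k\<close> for all \<open>k\<close>.\<close>

lemma derivation_mod_eq_vf:
  fixes D :: "'n::finite germ \<Rightarrow> 'n germ"
  assumes "derivation_mod (ideal S) D"
  shows "D g - vf (\<lambda>i. D (germ_coord i)) g \<in> ideal S"
proof -
  let ?I = "ideal S"
  define E where "E g = D g - vf (\<lambda>i. D (germ_coord i)) g" for g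
  have D_add: "D (g + h) - (D g + D h) \<in> ?I" and D_scale: "D (germ_const c * g) - germ_const c * D g \<in> ?I"
    and D_mult: "D (g * h) - (g * D h + h * D g) \<in> ?I" for g h c
    using assms by (auto simp: derivation_mod_def)
  have E_add: "E (g + h) - (E g + E h) \<in> ?I" for g h
    using D_add[of g h] by (simp add: E_def vf_add algebra_simps)
  have E_mult: "E (g * h) - (g * E h + h * E g) \<in> ?I" for g h
    using D_mult[of g h] by (simp add: E_def vf_mult algebra_simps)
  \<comment> \<open>The Leibniz rule for \<open>1 * 1\<close> reads
    \<open>- D 1 \<in> ?I\<close>.\<close>
  have E_one: "D 1 \<in> ?I"
    using ideal_neg[OF D_mult[of 1 1]] by simp
  have E_const: "E (germ_const c) \<in> ?I" for c
    using ideal_add[OF D_scale[of c 1] ideal_mult[OF E_one, of "germ_const c"]]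
    by (simp add: E_def vf_const)
  have E_coord: "E (germ_coord i) = 0" for i
    by (simp add: E_def vf_coord)
  have E_sum: "E (sum g A) - (\<Sum>x\<in>A. E (g x)) \<in> ?I" for g and A :: "'n set"
  proof (induction A rule: infinite_finite_induct)
    case (insert x F)
    have "E (sum g (insert x F)) - (\<Sum>x\<in>insert x F. E (g x)) =
       (E (g x + sum g F) - (E (g x) + E (sum g F))) + (E (sum g F) - (\<Sum>x\<in>F. E (g x)))"
      using insert by simp
    also have "\<dots> \<in> ?I"
      by (intro ideal_add E_add insert.IH)
    finally show ?case .
  qed (use E_const[of 0] in auto)
  have "\<exists>h\<in>?I. E g - h \<in> ord_ge k" for g k
  proof (induction k arbitrary: g)
    case 0
    show ?case by (intro bexI[of _ 0]) (auto simp: ideal_zero)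
  next
    case (Suc k)
    define c :: "'n germ" where "c = germ_const (germ_at_0 g)"
    have "g - c \<in> ord_ge (Suc 0)"
      using ord_ge_1_iff[of "g - c"] by (simp add: c_def)
    then obtain b where b: "g - c = (\<Sum>i\<in>UNIV. germ_coord i * b i)"
      using ord_ge_Suc_decompose by blast
    define p where "p = (\<Sum>i\<in>UNIV. germ_coord i * b i)"
    have g: "g = c + p"
      using b by (simp add: p_def algebra_simps)
    have "\<forall>i. \<exists>h. h \<in> ?I \<and> E (b i) - h \<in> ord_ge k"
      using Suc by blast
    from choice[OF this] obtain h where h: "\<And>i. h i \<in> ?I" "\<And>i. E (b i) - h i \<in> ord_ge k"
      by blast
    \<comment> \<open>Modulo the ideal, \<open>E\<close> kills constants and coordinates, so
      \<open>E g\<close> is congruent to \<open>q\<close>. The coordinate factors raise the order of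
      the induction hypothesis by one.\<close>
    define q where "q = (\<Sum>i\<in>UNIV. germ_coord i * E (b i))"
    have "(\<Sum>i\<in>UNIV. E (germ_coord i * b i) - germ_coord i * E (b i)) \<in> ?I"
      using E_mult[of "germ_coord _"] by (intro ideal_sum) (simp add: E_coord)
    then have "(\<Sum>i\<in>UNIV. E (germ_coord i * b i)) - q \<in> ?I"
      by (simp add: q_def sum_subtractf)
    from ideal_add[OF E_sum[of "\<lambda>i. germ_coord i * b i" UNIV] this]
    have "E p - q \<in> ?I"
      by (simp add: p_def)
    from ideal_add[OF ideal_add[OF E_add[of c p] this] E_const[of "germ_at_0 g"]]
    have Eq: "E g - q \<in> ?I"
      by (simp add: g[symmetric] c_def[symmetric] algebra_simps)
    have "E g - ((E g - q) + (\<Sum>i\<in>UNIV. germ_coord i * h i)) = (\<Sum>i\<in>UNIV. germ_coord i * (E (b i) - h i))"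
      by (simp add: q_def right_diff_distrib sum_subtractf)
    also have "\<dots> \<in> ord_ge (Suc k)"
      using ord_ge_mult[OF germ_coord_ord_ge h(2)] by (intro ord_ge_sum) simp
    finally show ?case
      by (rule bexI) (intro ideal_add Eq ideal_sum ideal_mult h)
  qed
  then have "E g \<in> ?I"
    by (intro krull_intersection)
  then show ?thesis
    by (simp add: E_def)
qed

section \<open>Products of operators X - l and their effect on the order\<close>

fun shift :: "('n::finite germ \<Rightarrow> 'n germ) \<Rightarrow> real list \<Rightarrow> 'n germ \<Rightarrow> 'n germ" where
  "shift X [] g = g"
| "shift X (l # ls) g = shift X ls (X g - germ_const (of_real l) * g)"

lemma shift_append: "shift X (xs @ ys) g = shift X ys (shift X xs g)"
  by (induction xs arbitrary: g) auto

lemma shift_add: "shift (vf a) xs (g + h) = shift (vf a) xs g + shift (vf a) xs h"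
proof (induction xs arbitrary: g h)
  case (Cons l xs)
  have "vf a (g + h) - germ_const (of_real l) * (g + h) =
      (vf a g - germ_const (of_real l) * g) + (vf a h - germ_const (of_real l) * h)"
    by (simp add: vf_add algebra_simps)
  then show ?case
    using Cons by simp
qed simp

text \<open>All factors are polynomials in one operator that is linear over the constants, hence
  commute.\<close>

lemma shift_Cons_commute:
  "shift (vf a) xs (vf a g - germ_const (of_real l) * g) =
   vf a (shift (vf a) xs g) - germ_const (of_real l) * shift (vf a) xs g"
proof (induction xs arbitrary: g)
  case (Cons m xs)
  have "vf a (vf a g - germ_const (of_real l) * g) - germ_const (of_real m) * (vf a g - germ_const (of_real l) * g)
      = vf a (vf a g - germ_const (of_real m) * g) - germ_const (of_real l) * (vf a g - germ_const (of_real m) * g)"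
    by (simp only: vf_diff vf_cmult) (simp add: algebra_simps)
  then show ?case
    using Cons[of "vf a g - germ_const (of_real m) * g"] by simp
qed simp

lemma shift_commute: "shift (vf a) xs (shift (vf a) ys g) = shift (vf a) ys (shift (vf a) xs g)"
  by (induction ys arbitrary: g) (simp_all add: shift_Cons_commute)

lemma shift_ord_ge:
  assumes "\<And>i. a i \<in> ord_ge 1" "g \<in> ord_ge k"
  shows "shift (vf a) xs g \<in> ord_ge k"
  using assms(2)
proof (induction xs arbitrary: g)
  case (Cons l xs)
  show ?case
    unfolding shift.simps
    by (intro Cons.IH ord_ge_diff vf_ord_ge ord_ge_mult_left assms(1) Cons.prems)
qed simp

text \<open>Eigenvalues add under products: subtracting \<open>l + m\<close> from the field on
  \<open>b * u\<close> equals subtracting \<open>m\<close> on \<open>b\<close>, times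
  \<open>u\<close>, plus \<open>b\<close> times the defect of \<open>u\<close>. The defect term has
  order \<open>k + 2\<close>, which further shifts preserve.\<close>

lemma shift_mult_eigen:
  fixes a :: "'n::finite \<Rightarrow> 'n germ"
  assumes a: "\<And>i. a i \<in> ord_ge 1" and u: "vf a u - germ_const (of_real l) * u \<in> ord_ge 2"
    and b: "b \<in> ord_ge k"
  shows "shift (vf a) (map ((+) l) xs) (b * u) - shift (vf a) xs b * u \<in> ord_ge (k + 2)"
  using b
proof (induction xs arbitrary: b)
  case (Cons m xs)
  let ?b = "vf a b - germ_const (of_real m) * b" and ?r = "b * (vf a u - germ_const (of_real l) * u)"
  have "?b \<in> ord_ge k"
    by (intro ord_ge_diff vf_ord_ge a ord_ge_mult_left Cons.prems)
  note IH = Cons.IH[OF this]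
  have "?r \<in> ord_ge (k + 2)"
    by (rule ord_ge_mult[OF Cons.prems u])
  then have r: "shift (vf a) (map ((+) l) xs) ?r \<in> ord_ge (k + 2)"
    by (rule shift_ord_ge[OF a])
  have "vf a (b * u) - germ_const (of_real (l + m)) * (b * u) = ?b * u + ?r"
    by (simp add: vf_mult algebra_simps)
  then have "shift (vf a) (map ((+) l) (m # xs)) (b * u) - shift (vf a) (m # xs) b * u
      = (shift (vf a) (map ((+) l) xs) (?b * u) - shift (vf a) xs ?b * u) + shift (vf a) (map ((+) l) xs) ?r"
    by (simp add: shift_add)
  also have "\<dots> \<in> ord_ge (k + 2)"
    by (rule ord_ge_add[OF IH r])
  finally show ?case .
qed simp

text \<open>The lists of the summands are concatenated: the operators commute, and none of them
  lowers the order.\<close>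

lemma shift_sum_raises_order:
  assumes a: "\<And>i. a i \<in> ord_ge 1"
    and "\<And>x. x \<in> A \<Longrightarrow> \<exists>xs. (\<forall>l\<in>set xs. 0 < l) \<and> shift (vf a) xs (g x) \<in> ord_ge k"
  shows "\<exists>xs. (\<forall>l\<in>set xs. 0 < l) \<and> shift (vf a) xs (sum g A) \<in> ord_ge k"
  using assms(2)
proof (induction A rule: infinite_finite_induct)
  case (insert x F)
  obtain xs where xs: "\<forall>l\<in>set xs. 0 < l" "shift (vf a) xs (g x) \<in> ord_ge k"
    using insert by blast
  obtain ys where ys: "\<forall>l\<in>set ys. 0 < l" "shift (vf a) ys (sum g F) \<in> ord_ge k"
    using insert by blast
  have "shift (vf a) (xs @ ys) (sum g (insert x F)) =
      shift (vf a) ys (shift (vf a) xs (g x)) + shift (vf a) xs (shift (vf a) ys (sum g F))"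
    using insert by (simp add: shift_append shift_add shift_commute)
  also have "\<dots> \<in> ord_ge k"
    by (intro ord_ge_add shift_ord_ge a xs ys)
  finally show ?case
    using xs ys by (intro exI[of _ "xs @ ys"]) auto
qed (auto intro!: exI[of _ "[]"])

text \<open>Modulo higher order, forms of degree \<open>k\<close> are spanned by
  \<open>k\<close>-fold products of the eigenvectors \<open>u v\<close>, whose eigenvalues are sums
  of \<open>k\<close> of the positive \<open>l v\<close>. Removing these eigenvalues raises the
  order, one degree at a time.\<close>

lemma ex_shift_ord_ge:
  fixes a :: "'n::finite \<Rightarrow> 'n germ"
  assumes a: "\<And>i. a i \<in> ord_ge 1"
    and u_l: "\<forall>v\<in>B. u v \<in> ord_ge 1 \<and> 0 < l v \<and> vf a (u v) - germ_const (of_real (l v)) * u v \<in> ord_ge 2"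
    and e: "\<forall>i. germ_coord i - (\<Sum>v\<in>B. germ_const (e i v) * u v) \<in> ord_ge 2"
    and g: "g \<in> ord_ge 1"
  shows "\<exists>xs. (\<forall>l\<in>set xs. 0 < l) \<and> shift (vf a) xs g \<in> ord_ge k"
proof -
  have u: "vf a (u v) - germ_const (of_real (l v)) * u v \<in> ord_ge 2" "u v \<in> ord_ge 1" "0 < l v"
    if "v \<in> B" for v
    using bspec[OF u_l that] by simp_all
  \<comment> \<open>In order 0 the eigenvalue is 0, so strict positivity is only claimed for
    positive \<open>k\<close>; adding some \<open>l v\<close> restores it in the induction
    step.\<close>
  have step: "\<exists>xs. (\<forall>l\<in>set xs. 0 \<le> l \<and> (0 < k \<longrightarrow> 0 < l)) \<and> shift (vf a) xs g \<in> ord_ge (Suc k)"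
    if "g \<in> ord_ge k" for g k
    using that
  proof (induction k arbitrary: g)
    case 0
    have "vf a g \<in> ord_ge 1"
      using ord_ge_mult[OF a ord_ge_0] unfolding vf_def by (intro ord_ge_sum) auto
    then show ?case
      by (intro exI[of _ "[0]"]) simp
  next
    case (Suc k)
    obtain b where b: "\<And>i. b i \<in> ord_ge k" "g = (\<Sum>i\<in>UNIV. germ_coord i * b i)"
      using ord_ge_Suc_decompose[OF Suc.prems] by blast
    define b' where "b' v = (\<Sum>i\<in>UNIV. germ_const (e i v) * b i)" for v
    \<comment> \<open>The error made by replacing each coordinate by its linear combination of
      eigenvectors.\<close>
    define r where "r = (\<Sum>i\<in>UNIV. b i * (germ_coord i - (\<Sum>v\<in>B. germ_const (e i v) * u v)))"
    have r: "r \<in> ord_ge (k + 2)"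
      unfolding r_def by (intro ord_ge_sum ord_ge_mult b spec[OF e])
    have b': "b' v \<in> ord_ge k" for v
      unfolding b'_def by (intro ord_ge_sum ord_ge_mult_left b)
    have "(\<Sum>v\<in>B. b' v * u v) = (\<Sum>i\<in>UNIV. \<Sum>v\<in>B. germ_const (e i v) * b i * u v)"
      unfolding b'_def sum_distrib_right by (rule sum.swap)
    also have "\<dots> = (\<Sum>i\<in>UNIV. b i * (\<Sum>v\<in>B. germ_const (e i v) * u v))"
      by (simp add: sum_distrib_left mult_ac)
    finally have g_eq: "g = (\<Sum>v\<in>B. b' v * u v) + r"
      by (simp add: b(2) r_def right_diff_distrib sum_subtractf mult.commute)
    have "\<exists>xs. (\<forall>l\<in>set xs. 0 < l) \<and> shift (vf a) xs (b' v * u v) \<in> ord_ge (k + 2)" if v: "v \<in> B" for v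
    proof -
      obtain xs where xs: "\<forall>l\<in>set xs. 0 \<le> l \<and> (0 < k \<longrightarrow> 0 < l)" "shift (vf a) xs (b' v) \<in> ord_ge (Suc k)"
        using Suc.IH[OF b'] by blast
      have "shift (vf a) xs (b' v) * u v \<in> ord_ge (k + 2)"
        using ord_ge_mult[OF xs(2) u(2)[OF v]] by simp
      from ord_ge_add[OF shift_mult_eigen[OF a u(1)[OF v] b'[of v], of xs] this]
      have "shift (vf a) (map ((+) (l v)) xs) (b' v * u v) \<in> ord_ge (k + 2)"
        by simp
      moreover have "\<forall>x\<in>set (map ((+) (l v)) xs). 0 < x"
        using xs(1) u(3)[OF v] by (auto intro: add_pos_nonneg)
      ultimately show ?thesis by blast
    qed
    from shift_sum_raises_order[where A = B and g = "\<lambda>v. b' v * u v", OF a this]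
    obtain xs where xs: "\<forall>l\<in>set xs. 0 < l" "shift (vf a) xs (\<Sum>v\<in>B. b' v * u v) \<in> ord_ge (k + 2)"
      by blast
    then have "shift (vf a) xs g \<in> ord_ge (k + 2)"
      unfolding g_eq shift_add by (intro ord_ge_add shift_ord_ge[OF a r])
    then show ?case
      using xs(1) by (intro exI[of _ xs]) (auto intro: less_imp_le)
  qed
  show ?thesis
  proof (induction k)
    case 0
    show ?case by (intro exI[of _ "[]"]) simp
  next
    case (Suc k)
    show ?case
    proof (cases "k = 0")
      case True
      then show ?thesis using g by (intro exI[of _ "[]"]) simp
    next
      case False
      obtain xs where xs: "\<forall>l\<in>set xs. 0 < l" "shift (vf a) xs g \<in> ord_ge k"
        using Suc by blast
      obtain ys where ys: "\<forall>l\<in>set ys. 0 < l" "shift (vf a) ys (shift (vf a) xs g) \<in> ord_ge (Suc k)"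
        using step[OF xs(2)] False by blast
      then show ?thesis
        using xs(1) by (intro exI[of _ "xs @ ys"]) (auto simp: shift_append)
    qed
  qed
qed

text \<open>The products of coordinates with elements of \<open>S\<close> generate m I, where I is
  the ideal of \<open>S\<close>.\<close>

lemma ord_ge_mult_ideal:
  fixes a :: "'n::finite germ"
  assumes "a \<in> ord_ge 1" "h \<in> ideal S"
  shows "a * h \<in> ideal {germ_coord j * s | j s. s \<in> S}" (is "_ \<in> ideal ?T")
  using assms(2)
proof (induction rule: ideal_induct)
  case base
  show ?case by (simp add: ideal_zero)
next
  case (step c s h)
  obtain b where b: "a = (\<Sum>i\<in>UNIV. germ_coord i * b i)"
    using ord_ge_Suc_decompose[of a 0] assms(1) by auto
  have "a * (c * s) = (\<Sum>i\<in>UNIV. (b i * c) * (germ_coord i * s))"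
    unfolding b sum_distrib_right by (simp add: mult_ac)
  also have "\<dots> \<in> ideal ?T"
    using step.hyps by (intro ideal_sum ideal_mult ideal_base) auto
  finally show ?case
    unfolding distrib_left using step.IH by (rule ideal_add)
qed

text \<open>If all partial derivatives of \<open>g\<close> lie in I, the field sends
  \<open>g\<close> into m I, so each factor acts as \<open>- l\<close> modulo m I. By the commutator
  formula and the stability of I the image again has its derivatives in I, so the induction
  continues and the scalars multiply up to a nonzero \<open>c\<close>.\<close>

lemma shift_mod_mult_ideal:
  fixes a :: "'n::finite \<Rightarrow> 'n germ"
  assumes a: "\<And>i. a i \<in> ord_ge 1"
    and stable: "\<forall>h\<in>ideal S. vf a h \<in> ideal S"
    and "\<And>j. germ_pd j g \<in> ideal S" "\<forall>l\<in>set xs. 0 < l"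
  shows "\<exists>c. c \<noteq> 0 \<and> shift (vf a) xs g - germ_const c * g \<in> ideal {germ_coord j * s | j s. s \<in> S}"
    (is "\<exists>c. _ \<and> _ \<in> ideal ?T")
  using assms(3,4)
proof (induction xs arbitrary: g)
  case Nil
  show ?case
    by (intro exI[of _ 1]) (simp add: ideal_zero)
next
  case (Cons l xs)
  let ?g = "vf a g - germ_const (of_real l) * g"
  have "vf (\<lambda>i. germ_pd j (a i)) g \<in> ideal S" for j
    unfolding vf_def by (intro ideal_sum ideal_mult Cons.prems)
  then have pd: "germ_pd j ?g \<in> ideal S" for j
    unfolding germ_pd_diff germ_pd_vf germ_pd_cmult
    by (intro ideal_diff ideal_add ideal_mult bspec[OF stable] Cons.prems)
  have "\<forall>l\<in>set xs. 0 < l"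
    using Cons.prems(2) by simp
  from Cons.IH[OF pd this]
  obtain c where c: "c \<noteq> 0" "shift (vf a) xs ?g - germ_const c * ?g \<in> ideal ?T"
    by blast
  have "vf a g \<in> ideal ?T"
    unfolding vf_def by (intro ideal_sum ord_ge_mult_ideal a Cons.prems)
  from ideal_add[OF c(2) ideal_mult[OF this, of "germ_const c"]]
  have "shift (vf a) (l # xs) g - germ_const (- c * of_real l) * g \<in> ideal ?T"
    by (simp add: algebra_simps)
  then show ?case
    using c(1) Cons.prems(2) by (intro exI[of _ "- c * of_real l"]) auto
qed

section \<open>Linear parts and the cotangent space\<close>

definition grad :: "'n::finite germ \<Rightarrow> complex^'n" where
  "grad g = (\<chi> i. germ_at_0 (germ_pd i g))"

text \<open>On m the gradient is the class modulo m^2: if \<open>g\<close> is the sum of the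
  products of coordinates with \<open>b j\<close>, then the \<open>j\<close>-th derivative at 0 is
  the value of \<open>b j\<close> there.\<close>

lemma ord_ge_2I:
  fixes g :: "'n::finite germ"
  assumes "germ_at_0 g = 0" "grad g = 0"
  shows "g \<in> ord_ge 2"
proof -
  have "g \<in> ord_ge (Suc 0)"
    using assms(1) ord_ge_1_iff[of g] by simp
  then obtain b where b: "g = (\<Sum>i\<in>UNIV. germ_coord i * b i)"
    using ord_ge_Suc_decompose by blast
  have "b j \<in> ord_ge 1" for j
  proof -
    have "germ_at_0 (germ_pd j g) = germ_at_0 (b j)"
      unfolding b by (simp add: germ_pd_mult if_distrib[of germ_at_0] if_distrib[of "\<lambda>x. _ * x"] cong: if_cong)
    moreover have "germ_at_0 (germ_pd j g) = 0"
      using assms(2) by (simp add: grad_def vec_eq_iff)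
    ultimately show ?thesis
      by (simp only: ord_ge_1_iff)
  qed
  then have "germ_coord i * b i \<in> ord_ge (Suc 0 + 1)" for i
    by (intro ord_ge_mult germ_coord_ord_ge)
  then show ?thesis
    unfolding b by (intro ord_ge_sum) (simp add: numeral_2_eq_2)
qed

lemma grad_add: "grad (g + h) = grad g + grad h"
  by (simp add: grad_def vec_eq_iff)

lemma grad_diff: "grad (g - h) = grad g - grad h"
  by (simp add: grad_def vec_eq_iff)

lemma grad_zero [simp]: "grad 0 = 0"
  by (simp add: grad_def vec_eq_iff)

lemma grad_sum: "grad (sum g A) = (\<Sum>x\<in>A. grad (g x))"
  by (induction A rule: infinite_finite_induct) (auto simp: grad_add)

lemma grad_cmult: "grad (germ_const c * g) = c *s grad g"
  by (simp add: grad_def vec_eq_iff)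

lemma grad_mult: "germ_at_0 h = 0 \<Longrightarrow> grad (g * h) = germ_at_0 g *s grad h"
  by (simp add: grad_def vec_eq_iff germ_pd_mult)

lemma grad_coord: "grad (germ_coord i) = axis i 1"
  by (auto simp: grad_def vec_eq_iff axis_def)

lemma ideal_at_0:
  assumes "\<And>s. s \<in> S \<Longrightarrow> germ_at_0 s = 0" "g \<in> ideal S"
  shows "germ_at_0 g = 0"
  using assms(2) by (induction rule: ideal_induct) (auto simp: assms(1))

text \<open>The gradients of \<open>U\<close> span the cotangent space; \<open>B\<close> is a basis of it, and \<open>b\<close> is the vector
  field that cancels the defects \<open>\<chi>u - l u \<in> I\<close> of the corresponding germs \<open>u\<close> modulo \<open>m\<^sup>2\<close>.\<close>

lemma exists_linearised_vf:
  fixes a\<^sub>0 :: "'n::finite \<Rightarrow> 'n germ"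
  assumes gen: "\<And>i. germ_coord i \<in> ideal U"
    and U: "\<forall>u\<in>U. germ_at_0 u = 0"
    and I: "\<forall>h\<in>ideal S. germ_at_0 h = 0"
    and eigen: "\<forall>u\<in>U. \<exists>l>0. vf a\<^sub>0 u - germ_const (of_real l) * u \<in> ideal S"
  shows "\<exists>b (B :: (complex^'n) set) u l e. (\<forall>i. b i \<in> ideal S \<and> a\<^sub>0 i + b i \<in> ord_ge 1) \<and>
    (\<forall>v\<in>B. u v \<in> ord_ge 1 \<and> (0::real) < l v \<and>
       vf (\<lambda>i. a\<^sub>0 i + b i) (u v) - germ_const (of_real (l v)) * u v \<in> ord_ge 2) \<and>
    (\<forall>i. germ_coord i - (\<Sum>v\<in>B. germ_const (e i v) * u v) \<in> ord_ge 2)"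
proof -
  \<comment> \<open>The eigen-relation holds modulo I, and \<open>u\<close> as well as all elements
    of I vanish at 0.\<close>
  have at_0: "germ_at_0 (vf a\<^sub>0 u) = 0" if uU: "u \<in> U" for u
  proof -
    obtain l where "vf a\<^sub>0 u - germ_const (of_real l) * u \<in> ideal S"
      using bspec[OF eigen uU] by blast
    from bspec[OF I this] bspec[OF U uU] show ?thesis by simp
  qed
  \<comment> \<open>By Leibniz the vanishing extends from \<open>U\<close> to its ideal, which
    contains the coordinates; their images are the coefficients of the field.\<close>
  have "germ_at_0 (vf a\<^sub>0 g) = 0" if "g \<in> ideal U" for g
    using that by (induction rule: ideal_induct) (simp_all add: at_0 bspec[OF U] vf_add vf_mult vf_def[of _ 0])
  from this[OF gen] have a0: "germ_at_0 (a\<^sub>0 i) = 0" for i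
    by (simp add: vf_coord)
  have "grad g \<in> vec.span (grad ` U)" if "g \<in> ideal U" for g
    using that
  proof (induction rule: ideal_induct)
    case (step c x y)
    then show ?case
      by (simp add: bspec[OF U] grad_add grad_mult vec.span_add vec.span_scale vec.span_base)
  qed (simp add: vec.span_zero)
  from this[OF gen] have axis_in: "axis i 1 \<in> vec.span (grad ` U)" for i :: 'n
    by (simp add: grad_coord)
  \<comment> \<open>The basis consists of gradients of generators, so each basis vector comes with a
    germ whose eigenvalue is known.\<close>
  obtain B where B: "B \<subseteq> grad ` U" "vec.independent B" "grad ` U \<subseteq> vec.span B"
    using vec.maximal_independent_subset by blast
  have axis_B: "axis i 1 \<in> vec.span B" for i :: 'n
    using axis_in vec.span_minimal[OF B(3) vec.subspace_span] by blast
  have finB: "finite B"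
    using B(2) by (rule vec.finiteI_independent)
  have "\<forall>v\<in>B. \<exists>u\<in>U. grad u = v"
    using B(1) by auto
  then obtain u where u: "\<And>v. v \<in> B \<Longrightarrow> u v \<in> U" "\<And>v. v \<in> B \<Longrightarrow> grad (u v) = v"
    by metis
  have "\<forall>v\<in>B. \<exists>l>0. vf a\<^sub>0 (u v) - germ_const (of_real l) * u v \<in> ideal S"
    using bspec[OF eigen u(1)] by blast
  then obtain l where l: "\<And>v. v \<in> B \<Longrightarrow> l v > 0"
      "\<And>v. v \<in> B \<Longrightarrow> vf a\<^sub>0 (u v) - germ_const (of_real (l v)) * u v \<in> ideal S"
    by metis
  define e where "e i = vec.representation B (axis i 1)" for i :: 'n
  have e_axis: "(\<Sum>v\<in>B. e i v *s v) = axis i 1" for i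
    unfolding e_def by (rule vec.sum_representation_eq[OF B(2) axis_B finB order_refl])
  \<comment> \<open>The numbers \<open>e i w\<close> are the coordinates of the standard basis with
    respect to \<open>B\<close>, so they form the dual basis of \<open>B\<close>.\<close>
  have e_dual: "(\<Sum>i\<in>UNIV. v $ i * e i w) = (if w = v then 1 else 0)" if "v \<in> B" for v w
  proof -
    have "v = (\<Sum>i\<in>UNIV. v $ i *s axis i 1)"
      by (simp add: vec_eq_iff axis_def if_distrib cong: if_cong)
    then have "vec.representation B v w = vec.representation B (\<Sum>i\<in>UNIV. v $ i *s axis i 1) w"
      by simp
    also have "\<dots> = (\<Sum>i\<in>UNIV. v $ i * e i w)"
      using B(2) axis_B
      by (simp add: vec.representation_sum vec.representation_scale vec.span_scale e_def)
    finally show ?thesis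
      using vec.representation_basis[OF B(2) that] by simp
  qed
  define c where "c v = vf a\<^sub>0 (u v) - germ_const (of_real (l v)) * u v" for v
  \<comment> \<open>By duality this solves the linear equations
    \<open>(\<Sum>i\<in>UNIV. b i * germ_const (v $ i)) = - c v\<close> for all \<open>v\<close> in
    \<open>B\<close> at once.\<close>
  define b where "b i = - (\<Sum>w\<in>B. germ_const (e i w) * c w)" for i
  have b_in: "b i \<in> ideal S" for i
    unfolding b_def c_def by (intro ideal_neg ideal_sum ideal_mult l)
  have b_ord: "b i \<in> ord_ge 1" for i
    using bspec[OF I b_in] by (simp only: ord_ge_1_iff)
  have u_at_0: "germ_at_0 (u v) = 0" if "v \<in> B" for v
    by (rule bspec[OF U u(1)[OF that]])
  show ?thesis
  proof (rule exI[of _ b], rule exI[of _ B], rule exI[of _ u], rule exI[of _ l], rule exI[of _ e], intro conjI allI ballI)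
    show "b i \<in> ideal S" for i
      by (rule b_in)
    show "a\<^sub>0 i + b i \<in> ord_ge 1" for i
      using bspec[OF I b_in, of i] a0[of i] by (simp only: ord_ge_1_iff germ_at_0_simps add_0)
    show "u v \<in> ord_ge 1" if "v \<in> B" for v
      using u_at_0[OF that] by (simp only: ord_ge_1_iff)
    show "0 < l v" if "v \<in> B" for v
      by (rule l(1)[OF that])
    show "vf (\<lambda>i. a\<^sub>0 i + b i) (u v) - germ_const (of_real (l v)) * u v \<in> ord_ge 2" if "v \<in> B" for v
    proof -
      have "(\<Sum>i\<in>UNIV. b i * germ_const (v $ i)) = - (\<Sum>i\<in>UNIV. \<Sum>w\<in>B. germ_const (v $ i * e i w) * c w)"
        by (simp add: b_def sum_distrib_left sum_distrib_right sum_negf mult_ac)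
      also have "\<dots> = - (\<Sum>w\<in>B. germ_const (\<Sum>i\<in>UNIV. v $ i * e i w) * c w)"
        by (subst sum.swap) (simp add: sum_distrib_right)
      also have "\<dots> = - (\<Sum>w\<in>B. if w = v then c w else 0)"
        unfolding e_dual[OF that] by (simp add: if_distrib[of germ_const] if_distrib[of "\<lambda>x. x * _"] cong: if_cong)
      also have "\<dots> = - c v"
        using that finB by simp
      \<comment> \<open>Replacing the derivatives of \<open>u v\<close> by their values
        \<open>v $ i\<close> at 0 costs products of two elements of m, so \<open>b\<close> cancels
        \<open>c v\<close> modulo m^2.\<close>
      finally have "(\<Sum>i\<in>UNIV. b i * (germ_pd i (u v) - germ_const (v $ i))) = vf b (u v) + c v"
        by (simp add: right_diff_distrib sum_subtractf vf_def)
      moreover have "b i * (germ_pd i (u v) - germ_const (v $ i)) \<in> ord_ge (1 + 1)" for i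
      proof (rule ord_ge_mult[OF b_ord])
        have "germ_at_0 (germ_pd i (u v)) = v $ i"
          using u(2)[OF that] by (auto simp: grad_def vec_eq_iff)
        then show "germ_pd i (u v) - germ_const (v $ i) \<in> ord_ge 1"
          by (simp only: ord_ge_1_iff germ_at_0_simps) simp
      qed
      then have "(\<Sum>i\<in>UNIV. b i * (germ_pd i (u v) - germ_const (v $ i))) \<in> ord_ge 2"
        by (intro ord_ge_sum) (simp add: numeral_2_eq_2)
      ultimately have "vf b (u v) + c v \<in> ord_ge 2"
        by simp
      also have "vf b (u v) + c v = vf (\<lambda>i. a\<^sub>0 i + b i) (u v) - germ_const (of_real (l v)) * u v"
        by (simp add: vf_add_coeff c_def algebra_simps)
      finally show ?thesis .
    qed
    show "germ_coord i - (\<Sum>v\<in>B. germ_const (e i v) * u v) \<in> ord_ge 2" for i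
      by (rule ord_ge_2I) (simp_all add: u_at_0 grad_diff grad_sum grad_cmult u(2) e_axis grad_coord)
  qed
qed

section \<open>Strong Euler homogeneity of germs\<close>

theorem germ_strongly_euler:
  fixes f :: "'n::finite germ"
  defines "S \<equiv> insert f (range (\<lambda>i. germ_pd i f))"
  assumes f: "germ_at_0 f = 0"
    and gen: "\<And>i. germ_coord i \<in> ideal (S \<union> Y)" and Y: "\<And>y. y \<in> Y \<Longrightarrow> germ_at_0 y = 0"
    and D: "derivation_mod (ideal S) D" and D_ideal: "\<And>h. h \<in> ideal S \<Longrightarrow> D h \<in> ideal S"
    and eigen: "\<And>y. y \<in> Y \<Longrightarrow> \<exists>w>0. D y - germ_const (of_real w) * y \<in> ideal S"
  shows "f \<in> ideal {germ_coord j * germ_pd i f | i j. True}"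
proof -
  let ?T = "{germ_coord j * s | j s. s \<in> S}" and ?R = "{germ_coord j * germ_pd i f | i j. True}"
  have f_in: "f \<in> ideal ?T"
  proof (cases "\<exists>i. germ_at_0 (germ_pd i f) \<noteq> 0")
    case True
    then obtain i where i: "germ_at_0 (germ_pd i f) \<noteq> 0"
      by blast
    \<comment> \<open>Normalises the unit among the derivatives to value 1 at 0; Nakayama's lemma
      with \<open>e = 1\<close> then shows that the ideal is the whole ring.\<close>
    define c where "c = 1 / germ_at_0 (germ_pd i f)"
    have "germ_const c * germ_pd i f \<in> ideal S"
      by (intro ideal_mult ideal_base) (simp add: S_def)
    then have "1 - (1 - germ_const c * germ_pd i f) * 1 \<in> ideal S"
      by simp
    moreover have "1 - germ_const c * germ_pd i f \<in> ord_ge 1"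
      unfolding ord_ge_1_iff using i by (simp add: c_def)
    ultimately have "1 \<in> ideal S"
      by (rule nakayama)
    moreover have "f \<in> ord_ge 1"
      using f by (simp only: ord_ge_1_iff)
    ultimately show ?thesis
      using ord_ge_mult_ideal[of f 1 S] by simp
  next
    case False
    then have S_at_0: "germ_at_0 s = 0" if "s \<in> S" for s
      using that f by (auto simp: S_def)
    define a where "a i = D (germ_coord i)" for i
    have D_vf: "D g - vf a g \<in> ideal S" for g
      using derivation_mod_eq_vf[OF D] by (simp add: a_def[abs_def])
    have vf_a: "vf a h \<in> ideal S" if "h \<in> ideal S" for h
      using ideal_diff[OF D_ideal[OF that] D_vf[of h]] by simp
    \<comment> \<open>The given generators generate m only modulo I, so \<open>S\<close> is added to
      them. On \<open>S\<close> any positive eigenvalue will do, as both terms lie in I; 1 is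
      chosen.\<close>
    have eigen_U: "\<forall>u\<in>S \<union> Y. \<exists>l>0. vf a u - germ_const (of_real l) * u \<in> ideal S"
    proof
      fix u assume "u \<in> S \<union> Y"
      show "\<exists>l>0. vf a u - germ_const (of_real l) * u \<in> ideal S"
      proof (cases "u \<in> S")
        case True
        then have "u \<in> ideal S"
          by (rule ideal_base)
        then have "vf a u - u \<in> ideal S"
          by (intro ideal_diff vf_a)
        then show ?thesis
          by (intro exI[of _ 1]) simp
      next
        case False
        then obtain w where "w > 0" "D u - germ_const (of_real w) * u \<in> ideal S"
          using eigen[of u] \<open>u \<in> S \<union> Y\<close> by blast
        with ideal_diff[OF this(2) D_vf[of u]] show ?thesis
          by (intro exI[of _ w]) simp
      qed
    qed
    have U_at_0: "\<forall>u\<in>S \<union> Y. germ_at_0 u = 0"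
      using S_at_0 Y by blast
    have I_at_0: "\<forall>h\<in>ideal S. germ_at_0 h = 0"
      by (intro ballI ideal_at_0[OF S_at_0])
    from exists_linearised_vf[OF gen U_at_0 I_at_0 eigen_U]
    obtain b u l e and B :: "(complex^'n) set" where
      b_ab: "\<forall>i. b i \<in> ideal S \<and> a i + b i \<in> ord_ge 1"
      and u_l: "\<forall>v\<in>B. u v \<in> ord_ge 1 \<and> (0::real) < l v \<and>
          vf (\<lambda>i. a i + b i) (u v) - germ_const (of_real (l v)) * u v \<in> ord_ge 2"
      and e: "\<forall>i. germ_coord i - (\<Sum>v\<in>B. germ_const (e i v) * u v) \<in> ord_ge 2"
      by (elim exE conjE) (rule that)
    have b: "b i \<in> ideal S" and ab: "a i + b i \<in> ord_ge 1" for i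
      using spec[OF b_ab, of i] by auto
    let ?X = "\<lambda>i. a i + b i"
    have stable: "\<forall>h\<in>ideal S. vf ?X h \<in> ideal S"
    proof
      fix h assume "h \<in> ideal S"
      have "vf b h \<in> ideal S"
        unfolding vf_def by (intro ideal_sum) (subst mult.commute, rule ideal_mult[OF b])
      then show "vf ?X h \<in> ideal S"
        unfolding vf_add_coeff using \<open>h \<in> ideal S\<close> by (intro ideal_add vf_a)
    qed
    have pd_f: "germ_pd j f \<in> ideal S" for j
      by (rule ideal_base) (simp add: S_def)
    have f1: "f \<in> ord_ge 1"
      using f by (simp only: ord_ge_1_iff)
    show ?thesis
    proof (rule krull_intersection)
      fix k
      obtain xs where xs: "\<forall>l\<in>set xs. 0 < l" "shift (vf ?X) xs f \<in> ord_ge k"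
        using ex_shift_ord_ge[OF ab u_l e f1] by blast
      obtain c where c: "c \<noteq> 0" "shift (vf ?X) xs f - germ_const c * f \<in> ideal ?T"
        using shift_mod_mult_ideal[OF ab stable pd_f xs(1)] by blast
      \<comment> \<open>The product of shifts acts on \<open>f\<close> as the scalar
        \<open>c\<close> modulo m I. The factor is chosen so that \<open>h\<close> lies in m I and
        \<open>f - h\<close> is the shifted \<open>f\<close> divided by \<open>c\<close>, hence of
        order \<open>k\<close>.\<close>
      define h where "h = germ_const (- (1 / c)) * (shift (vf ?X) xs f - germ_const c * f)"
      have inv: "germ_const (1 / c) * (germ_const c * f) = f"
        unfolding mult.assoc[symmetric] germ_const_simps(4)[symmetric] using c(1) by simp
      have "h = - (germ_const (1 / c) * (shift (vf ?X) xs f - germ_const c * f))"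
        unfolding h_def germ_const_simps(5) by simp
      then have "h = f - germ_const (1 / c) * shift (vf ?X) xs f"
        by (simp add: right_diff_distrib inv)
      then have eq: "f - h = germ_const (1 / c) * shift (vf ?X) xs f"
        by simp
      have "f - h \<in> ord_ge k"
        unfolding eq by (rule ord_ge_mult_left[OF xs(2)])
      moreover have "h \<in> ideal ?T"
        unfolding h_def by (rule ideal_mult[OF c(2)])
      ultimately show "\<exists>h\<in>ideal ?T. f - h \<in> ord_ge k"
        by (rule bexI)
    qed
  qed
  \<comment> \<open>Generators of m I built from \<open>f\<close> are collected into a multiple of
    \<open>f\<close> with factor in m; all others belong to \<open>?R\<close>. Applied to
    \<open>f\<close> itself, this is the hypothesis of Nakayama's lemma.\<close>
  have "\<exists>g\<in>ord_ge 1. h - g * f \<in> ideal ?R" if "h \<in> ideal ?T" for h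
    using that
  proof (induction rule: ideal_induct)
    case base
    show ?case
      by (intro bexI[of _ 0]) (simp_all add: ideal_zero)
  next
    case (step c x y)
    obtain g where g: "g \<in> ord_ge 1" "y - g * f \<in> ideal ?R"
      using step.IH by (rule bexE)
    obtain j s where x: "x = germ_coord j * s" "s \<in> S"
      using step.hyps by blast
    show ?case
    proof (cases "s = f")
      case True
      have eq: "c * x + y - (c * germ_coord j + g) * f = y - g * f"
        by (simp add: x True algebra_simps)
      have "c * x + y - (c * germ_coord j + g) * f \<in> ideal ?R"
        unfolding eq by (rule g(2))
      moreover have "c * germ_coord j + g \<in> ord_ge 1"
        using g(1) by (simp only: ord_ge_1_iff germ_at_0_simps) simp
      ultimately show ?thesis
        by (rule bexI)
    next
      case False
      then have "x \<in> ?R"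
        using x by (auto simp: S_def)
      then have "c * x + (y - g * f) \<in> ideal ?R"
        by (intro ideal_add ideal_mult g(2) ideal_base)
      then show ?thesis
        using g(1) by (intro bexI[of _ g]) (simp_all add: add_diff_eq)
    qed
  qed
  from this[OF f_in] obtain g where g: "g \<in> ord_ge 1" "f - g * f \<in> ideal ?R"
    by (rule bexE)
  show ?thesis
    by (rule nakayama[OF g(2,1)])
qed

section \<open>From germs to functions\<close>

lemma germ_of_eq_iff:
  assumes "cps g" "cps h"
  shows "germ_of g = germ_of h \<longleftrightarrow> (\<forall>\<^sub>F z in nhds 0. g z = h z)"
  using assms Quotient_rel[OF Quotient_germ, of g h] by auto

lemma cps_rep_germ: "cps (rep_germ g)"
  using Quotient_rep_reflp[OF Quotient_germ] by blast

lemma germ_of_rep_germ: "germ_of (rep_germ g) = g"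
  by (rule Quotient_abs_rep[OF Quotient_germ])

lemma germ_of_add: "cps g \<Longrightarrow> cps h \<Longrightarrow> germ_of (\<lambda>z. g z + h z) = germ_of g + germ_of h"
  by (simp add: plus_germ.abs_eq eq_onp_def)

lemma germ_of_diff: "cps g \<Longrightarrow> cps h \<Longrightarrow> germ_of (\<lambda>z. g z - h z) = germ_of g - germ_of h"
  by (simp add: minus_germ.abs_eq eq_onp_def)

lemma germ_of_mult: "cps g \<Longrightarrow> cps h \<Longrightarrow> germ_of (\<lambda>z. g z * h z) = germ_of g * germ_of h"
  by (simp add: times_germ.abs_eq eq_onp_def)

lemma germ_of_const: "germ_of (\<lambda>_. a) = germ_const a"
  by (simp add: germ_const.abs_eq)

lemma germ_of_coord: "germ_of (\<lambda>z. z $ i) = germ_coord i"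
  by (simp add: germ_coord.abs_eq)

lemma germ_of_pd: "cps g \<Longrightarrow> germ_of (pd i g) = germ_pd i (germ_of g)"
  by (simp add: germ_pd.abs_eq eq_onp_def)

lemma germ_at_0_germ_of: "cps g \<Longrightarrow> germ_at_0 (germ_of g) = g 0"
  by (simp add: germ_at_0.abs_eq eq_onp_def)

lemma germ_of_sum:
  "(\<And>x. x \<in> A \<Longrightarrow> cps (g x)) \<Longrightarrow> germ_of (\<lambda>z. \<Sum>x\<in>A. g x z) = (\<Sum>x\<in>A. germ_of (g x))"
proof (induction A rule: infinite_finite_induct)
  case (insert x F)
  then show ?case
    by (simp add: germ_of_add cps_sum)
qed (simp_all add: germ_of_const)

text \<open>Finite combinations of functions near 0 correspond to finite combinations of germs;
  coefficients are transported by taking germs and by choosing representatives.\<close>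

lemma ideal_gen_iff:
  fixes S :: "(complex^'n::finite \<Rightarrow> complex) set"
  assumes "S \<subseteq> Collect cps" "cps g"
  shows "ideal_gen S g \<longleftrightarrow> germ_of g \<in> ideal (germ_of ` S)"
proof
  assume "ideal_gen S g"
  then obtain F a where F: "finite F" "F \<subseteq> S" "\<And>h. h \<in> F \<Longrightarrow> cps (a h)"
      "\<forall>\<^sub>F z in nhds 0. g z = (\<Sum>h\<in>F. a h z * h z)"
    by (auto simp: ideal_gen_def)
  have cps: "cps (\<lambda>z. a h z * h z)" if "h \<in> F" for h
    using F that assms(1) by (intro cps_mult) auto
  have "germ_of g = germ_of (\<lambda>z. \<Sum>h\<in>F. a h z * h z)"
    using F(4) assms(2) by (subst germ_of_eq_iff) (auto intro!: cps_sum cps)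
  also have "\<dots> = (\<Sum>h\<in>F. germ_of (\<lambda>z. a h z * h z))"
    by (rule germ_of_sum[OF cps])
  also have "\<dots> = (\<Sum>h\<in>F. germ_of (a h) * germ_of h)"
    using F assms(1) by (intro sum.cong refl germ_of_mult) auto
  also have "\<dots> \<in> ideal (germ_of ` S)"
    using F(2) by (intro ideal_sum ideal_mult ideal_base) auto
  finally show "germ_of g \<in> ideal (germ_of ` S)" .
next
  assume "germ_of g \<in> ideal (germ_of ` S)"
  then obtain t r where t: "finite t" "t \<subseteq> germ_of ` S" "germ_of g = (\<Sum>x\<in>t. r x * x)"
    unfolding ideal_explicit by blast
  \<comment> \<open>One function is chosen for each germ, so that the sum over germs can be
    reindexed by functions.\<close>
  obtain F where F: "F \<subseteq> S" "inj_on germ_of F" "t = germ_of ` F"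
    using t(2) by (auto simp: subset_image_inj)
  define a where "a h = rep_germ (r (germ_of h))" for h
  have cps: "cps (a h)" for h
    unfolding a_def by (rule cps_rep_germ)
  have cps': "cps (\<lambda>z. a h z * h z)" if "h \<in> F" for h
    using F that assms(1) by (intro cps_mult cps) auto
  have "germ_of g = (\<Sum>h\<in>F. germ_of (a h) * germ_of h)"
    unfolding t(3) F(3) by (simp add: sum.reindex[OF F(2)] a_def germ_of_rep_germ)
  also have "\<dots> = (\<Sum>h\<in>F. germ_of (\<lambda>z. a h z * h z))"
    using F assms(1) by (intro sum.cong refl germ_of_mult[symmetric] cps) auto
  also have "\<dots> = germ_of (\<lambda>z. \<Sum>h\<in>F. a h z * h z)"
    by (rule germ_of_sum[OF cps', symmetric])
  finally have "\<forall>\<^sub>F z in nhds 0. g z = (\<Sum>h\<in>F. a h z * h z)"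
    using assms(2) by (subst (asm) germ_of_eq_iff) (auto intro!: cps_sum cps')
  moreover have "finite F"
    using t(1) F by (simp add: finite_image_iff)
  ultimately show "ideal_gen S g"
    unfolding ideal_gen_def using F(1) cps by blast
qed

lemma congr_iff:
  assumes "S \<subseteq> Collect cps" "cps g" "cps h"
  shows "congr S g h \<longleftrightarrow> germ_of g - germ_of h \<in> ideal (germ_of ` S)"
  unfolding congr_def using assms by (subst ideal_gen_iff) (auto simp: cps_diff germ_of_diff)

text \<open>Functions with the same germ are congruent modulo \<open>S\<close>, so \<open>D\<close>
  takes congruent values on them. Evaluating \<open>D\<close> on a chosen representative therefore
  gives an operator on germs that inherits the derivation laws modulo the ideal.\<close>

lemma quot_derivation_germ:
  fixes D :: "(complex^'n::finite \<Rightarrow> complex) \<Rightarrow> complex^'n \<Rightarrow> complex"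
  assumes S: "S \<subseteq> Collect cps" and D: "quot_derivation S D"
  defines "I \<equiv> ideal (germ_of ` S)" and "D' \<equiv> \<lambda>g. germ_of (D (rep_germ g))"
  shows "derivation_mod I D'" "g - h \<in> I \<Longrightarrow> D' g - D' h \<in> I"
    and "cps y \<Longrightarrow> germ_of (D y) - D' (germ_of y) \<in> I"
proof -
  have cps_D: "cps (D g)" if "cps g" for g
    using D that by (simp add: quot_derivation_def)
  have cong: "germ_of (D g) - germ_of (D h) \<in> I" if "cps g" "cps h" "germ_of g - germ_of h \<in> I" for g h
  proof -
    have "congr S g h"
      using that by (simp add: congr_iff[OF S] I_def)
    then have "congr S (D g) (D h)"
      using D that(1,2) by (simp add: quot_derivation_def)
    then show ?thesis
      using that(1,2) by (simp add: congr_iff[OF S] cps_D I_def)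
  qed
  show "D' g - D' h \<in> I" if "g - h \<in> I" for g h
    unfolding D'_def using that by (intro cong) (simp_all add: cps_rep_germ germ_of_rep_germ)
  show lift: "germ_of (D y) - D' (germ_of y) \<in> I" if "cps y" for y
    unfolding D'_def using that
    by (intro cong) (simp_all add: cps_rep_germ germ_of_rep_germ I_def ideal_zero)
  have lift': "germ_of (D y) - D' g \<in> I" if "cps y" "germ_of y = g" for y g
    using lift[OF that(1)] unfolding that(2) .
  \<comment> \<open>Permits computing with any convenient function for the germ, such as a pointwise
    sum or product, instead of the chosen representative.\<close>
  have I_trans: "D' g - x \<in> I" if "cps y" "germ_of y = g" "germ_of (D y) - x \<in> I" for g x y
    using ideal_diff[OF that(3)[unfolded I_def] lift'[OF that(1,2), unfolded I_def]] by (simp add: I_def)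
  have 1: "D' (g + h) - (D' g + D' h) \<in> I" for g h
  proof (rule I_trans)
    have "congr S (D (\<lambda>z. rep_germ g z + rep_germ h z)) (\<lambda>z. D (rep_germ g) z + D (rep_germ h) z)"
      using D by (simp add: quot_derivation_def cps_rep_germ)
    then show "germ_of (D (\<lambda>z. rep_germ g z + rep_germ h z)) - (D' g + D' h) \<in> I"
      by (simp add: congr_iff[OF S] cps_D cps_add cps_rep_germ germ_of_add D'_def I_def)
  qed (simp_all add: cps_add cps_rep_germ germ_of_add germ_of_rep_germ)
  have 2: "D' (germ_const c * g) - germ_const c * D' g \<in> I" for c g
  proof (rule I_trans)
    have "congr S (D (\<lambda>z. c * rep_germ g z)) (\<lambda>z. c * D (rep_germ g) z)"
      using D by (simp add: quot_derivation_def cps_rep_germ)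
    then show "germ_of (D (\<lambda>z. c * rep_germ g z)) - germ_const c * D' g \<in> I"
      by (simp add: congr_iff[OF S] cps_D cps_cmult cps_const cps_rep_germ germ_of_mult germ_of_const D'_def I_def)
  qed (simp_all add: cps_cmult cps_const cps_rep_germ germ_of_mult germ_of_const germ_of_rep_germ)
  have 3: "D' (g * h) - (g * D' h + h * D' g) \<in> I" for g h
  proof (rule I_trans)
    have "congr S (D (\<lambda>z. rep_germ g z * rep_germ h z))
        (\<lambda>z. rep_germ g z * D (rep_germ h) z + rep_germ h z * D (rep_germ g) z)"
      using D by (simp add: quot_derivation_def cps_rep_germ)
    then show "germ_of (D (\<lambda>z. rep_germ g z * rep_germ h z)) - (g * D' h + h * D' g) \<in> I"
      by (simp add: congr_iff[OF S] cps_D cps_add cps_mult cps_rep_germ germ_of_add germ_of_mult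
          germ_of_rep_germ D'_def I_def)
  qed (simp_all add: cps_mult cps_rep_germ germ_of_mult germ_of_rep_germ)
  from 1 2 3 show "derivation_mod I D'"
    by (simp add: derivation_mod_def)
qed

theorem theorem4p6:
  fixes f :: "complex^'n::finite \<Rightarrow> complex"
  assumes "cps f"
    and "\<not> (\<forall>\<^sub>F z in nhds 0. f z = 0)"
    and "f 0 = 0"
    and "quasihomogeneous (sing_gens f)"
  shows "strongly_euler_homogeneous f"
proof -
  let ?S = "sing_gens f" and ?R = "{(\<lambda>z. z $ j * pd i f z) | i j. True}"
  have S: "?S \<subseteq> Collect cps"
    using assms(1) by (auto simp: sing_gens_def cps_pd)
  have germ_S: "germ_of ` ?S = insert (germ_of f) (range (\<lambda>i. germ_pd i (germ_of f)))"
    using assms(1) by (auto simp: sing_gens_def image_image germ_of_pd)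
  obtain ys w D where ys: "min_gens_max ?S ys" and w: "\<And>i. i < length ys \<Longrightarrow> w i > (0::real)"
    and D: "quot_derivation ?S D"
    and Dy: "\<And>i. i < length ys \<Longrightarrow> congr ?S (D (ys ! i)) (\<lambda>z. complex_of_real (w i) * (ys ! i) z)"
    using assms(4) unfolding quasihomogeneous_def by blast
  have ys_max: "cps y" "y 0 = 0" if "y \<in> set ys" for y
    using ys that by (auto simp: min_gens_max_def gens_max_def max_ideal_def)
  let ?I = "ideal (germ_of ` ?S)"
  define D' where "D' g = germ_of (D (rep_germ g))" for g
  note D' = quot_derivation_germ[OF S D, folded D'_def]
  have "germ_of f \<in> ideal {germ_coord j * germ_pd i (germ_of f) | i j. True}"
  proof (rule germ_strongly_euler[of "germ_of f" "germ_of ` set ys" D', folded germ_S])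
    show "germ_at_0 (germ_of f) = 0"
      using assms(1,3) by (simp add: germ_at_0_germ_of)
    show "germ_at_0 y = 0" if "y \<in> germ_of ` set ys" for y
      using that ys_max by (auto simp: germ_at_0_germ_of)
    show "germ_coord i \<in> ideal (germ_of ` ?S \<union> germ_of ` set ys)" for i
    proof -
      have "(\<lambda>z. z $ i) \<in> max_ideal"
        by (simp add: max_ideal_def cps_coord)
      then have "ideal_gen (?S \<union> set ys) (\<lambda>z. z $ i)"
        using ys by (auto simp: min_gens_max_def gens_max_def)
      then show ?thesis
        using S ys_max by (subst (asm) ideal_gen_iff) (auto simp: cps_coord germ_of_coord image_Un)
    qed
    show "derivation_mod ?I D'"
      by (rule D'(1))
    show "D' h \<in> ?I" if "h \<in> ?I" for h
    proof -
      \<comment> \<open>The laws hold only modulo the ideal, so the value at 0 is obtained from the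
        scalar rule with scalar 0.\<close>
      have "D' 0 \<in> ?I"
      proof -
        have "D' (germ_const 0 * 0) - germ_const 0 * D' 0 \<in> ?I"
          using D'(1) unfolding derivation_mod_def by blast
        then show ?thesis by simp
      qed
      moreover have "D' h - D' 0 \<in> ?I"
        by (rule D'(2)) (simp only: diff_zero that)
      ultimately have "(D' h - D' 0) + D' 0 \<in> ?I"
        by (intro ideal_add)
      then show ?thesis by simp
    qed
    show "\<exists>w>0. D' y - germ_const (complex_of_real w) * y \<in> ?I" if y: "y \<in> germ_of ` set ys" for y
    proof -
      obtain i where i: "i < length ys" "y = germ_of (ys ! i)"
        using y by (auto simp: in_set_conv_nth)
      then have cps: "cps (ys ! i)"
        using ys_max by simp
      have "cps (D (ys ! i))"
        using D cps by (simp add: quot_derivation_def)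
      then have "germ_of (D (ys ! i)) - germ_const (of_real (w i)) * y \<in> ?I"
        using Dy[OF i(1)] cps S i(2)
        by (subst (asm) congr_iff) (auto simp: cps_cmult germ_of_mult cps_const germ_of_const)
      from ideal_diff[OF this D'(3)[OF cps]] show ?thesis
        using w[OF i(1)] i(2) by (intro exI[of _ "w i"]) simp
    qed
  qed
  moreover have "{germ_coord j * germ_pd i (germ_of f) | i j. True} \<subseteq> germ_of ` ?R"
  proof clarify
    fix i j
    have eq: "germ_coord j * germ_pd i (germ_of f) = germ_of (\<lambda>z. z $ j * pd i f z)"
      using assms(1) by (simp add: germ_of_mult cps_coord cps_pd germ_of_coord germ_of_pd)
    show "germ_coord j * germ_pd i (germ_of f) \<in> germ_of ` ?R"
      unfolding eq by (rule imageI) blast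
  qed
  ultimately have "germ_of f \<in> ideal (germ_of ` ?R)"
    by (rule subsetD[OF ideal_mono, rotated])
  then show ?thesis
    unfolding strongly_euler_homogeneous_def using assms(1)
    by (subst ideal_gen_iff) (auto intro!: cps_mult cps_coord cps_pd)
qed

end
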